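(* Let $0<\alpha<1/3$, $d>0$, $\beta\ge1$. Then the system $\dot\theta=F_1(\theta,W)$, $\dot W=F_2(\theta,W)$ on $\Omega_\beta$ has exactly two equilibrium points $(\theta_*,0)$ and $(\theta_{**},0)$, with $0<\theta_*<\theta_\beta$ and $\theta_\beta<\theta_{**}<\pi/2$. Moreover, for every $(\theta_0,W_0)\in\Omega_\beta$ the following are equivalent: (i) the solution with initial data $(\theta_0,W_0)$ is a leapfrogging solution; (ii) $\theta_0\in(\theta_*,\theta_{**})$ and $\mathcal H(\theta_0,W_0)<\min\{\mathcal H(\theta_*,0),\mathcal H(\theta_{**},0)\}$.
   Context: Let $\theta_\beta=\arctan(\beta^{-1/2})\in(0,\pi/2)$ (the unique $\theta\in(0,\pi/2)$ with $\beta^{1/2}\sin\theta=\cos\theta$) and $\Omega_\beta=\{(\theta,W)\in\mathbb{R}^2:\ 0<\theta<\pi/2,\ W\in\mathbb{R},\ (\theta,W)\neq(\theta_\beta,0)\}$. Put $D_\beta(\theta,W)=\frac{d^2}{\beta}(\beta^{1/2}\sin\theta-\cos\theta)^2+W^2$, $$F_1(\theta,W)=\frac{\alpha\beta^{1/2}W}{D_\beta^{3/2}},\qquad F_2(\theta,W)=\frac{\beta^{3/2}\sin\theta-\cos\theta}{d\sin\theta\cos\theta}-\frac{\alpha d^2(\sin\theta+\beta^{1/2}\cos\theta)(\beta^{1/2}\sin\theta-\cos\theta)}{\beta^{1/2}D_\beta^{3/2}},$$ $$\mathcal H(\theta,W)=\frac{1}{2d}\log\!\left(\frac{(1-\sin\theta)^{\beta^{3/2}}(1-\cos\theta)}{(1+\sin\theta)^{\beta^{3/2}}(1+\cos\theta)}\right)-\frac{\alpha\beta^{1/2}}{D_\beta^{1/2}}.$$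 Solutions of this system with data in $\Omega_\beta$ exist globally in time. A solution $(\theta(t),W(t))$, $t\in\mathbb{R}$, is called a leapfrogging solution if it is non-constant and periodic and its orbit $\{(\theta(t),W(t)):t\in\mathbb{R}\}$ is a closed curve in $\Omega_\beta$ revolving around $(\theta_\beta,0)$, i.e. $(\theta_\beta,0)$ lies in the bounded component of the complement of the orbit in $\mathbb{R}^2$. (The system models two coaxial circular vortex filaments of radii $d\beta^{-1/2}\cos\theta$, $d\sin\theta$ and axial separation $W$; leapfrogging means they pass through each other periodically.) *)

theory Defs
  imports "HOL-Analysis.Analysis"
begin

definition theta_beta :: "real \<Rightarrow> real" where
  "theta_beta \<beta> = arctan (1 / sqrt \<beta>)"

definition Omega :: "real \<Rightarrow> (real \<times> real) set" where
  "Omega \<beta> = {(\<theta>, W). 0 < \<theta> \<and> \<theta> < pi / 2 \<and> (\<theta>, W) \<noteq> (theta_beta \<beta>, 0)}"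

definition Dbeta :: "real \<Rightarrow> real \<Rightarrow> real \<Rightarrow> real \<Rightarrow> real" where
  "Dbeta \<beta> d \<theta> W = d\<^sup>2 / \<beta> * (sqrt \<beta> * sin \<theta> - cos \<theta>)\<^sup>2 + W\<^sup>2"

definition F1 :: "real \<Rightarrow> real \<Rightarrow> real \<Rightarrow> real \<Rightarrow> real \<Rightarrow> real" where
  "F1 \<alpha> \<beta> d \<theta> W = \<alpha> * sqrt \<beta> * W / (Dbeta \<beta> d \<theta> W powr (3/2))"

definition F2 :: "real \<Rightarrow> real \<Rightarrow> real \<Rightarrow> real \<Rightarrow> real \<Rightarrow> real" where
  "F2 \<alpha> \<beta> d \<theta> W =
     (\<beta> powr (3/2) * sin \<theta> - cos \<theta>) / (d * sin \<theta> * cos \<theta>)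
     - \<alpha> * d\<^sup>2 * (sin \<theta> + sqrt \<beta> * cos \<theta>) * (sqrt \<beta> * sin \<theta> - cos \<theta>)
         / (sqrt \<beta> * Dbeta \<beta> d \<theta> W powr (3/2))"

definition Ham :: "real \<Rightarrow> real \<Rightarrow> real \<Rightarrow> real \<Rightarrow> real \<Rightarrow> real" where
  "Ham \<alpha> \<beta> d \<theta> W =
     1 / (2 * d) * ln (((1 - sin \<theta>) powr (\<beta> powr (3/2)) * (1 - cos \<theta>))
                     / ((1 + sin \<theta>) powr (\<beta> powr (3/2)) * (1 + cos \<theta>)))
     - \<alpha> * sqrt \<beta> / sqrt (Dbeta \<beta> d \<theta> W)"

definition VF :: "real \<Rightarrow> real \<Rightarrow> real \<Rightarrow> real \<times> real \<Rightarrow> real \<times> real" where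
  "VF \<alpha> \<beta> d p = (F1 \<alpha> \<beta> d (fst p) (snd p), F2 \<alpha> \<beta> d (fst p) (snd p))"

definition is_solution :: "real \<Rightarrow> real \<Rightarrow> real \<Rightarrow> (real \<Rightarrow> real \<times> real) \<Rightarrow> bool" where
  "is_solution \<alpha> \<beta> d x \<longleftrightarrow>
     (\<forall>t. x t \<in> Omega \<beta> \<and> (x has_vector_derivative VF \<alpha> \<beta> d (x t)) (at t))"

definition leapfrogging :: "real \<Rightarrow> (real \<Rightarrow> real \<times> real) \<Rightarrow> bool" where
  "leapfrogging \<beta> x \<longleftrightarrow>
     (\<exists>t s. x t \<noteq> x s) \<and>
     (\<exists>T>0. \<forall>t. x (t + T) = x t) \<and>
     range x \<subseteq> Omega \<beta> \<and>
     (theta_beta \<beta>, 0) \<notin> range x \<and>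
     bounded (connected_component_set (- range x) (theta_beta \<beta>, 0))"

end

theory Submission
  imports Defs
begin

text \<open>
  The system is Hamiltonian: \<open>\<theta>' = \<partial>H/\<partial>W\<close>, \<open>W' = - \<partial>H/\<partial>\<theta>\<close>. On the axis
  \<open>W = 0\<close> the function \<open>\<theta> \<mapsto> F2 \<theta> 0\<close> is strictly increasing on each side of \<open>\<theta>\<^sub>\<beta>\<close>, so that \<open>H\<close>
  restricted to the axis has exactly one critical point, a maximum, on each side.

  A leapfrogging orbit has to meet the axis on both sides of \<open>\<theta>\<^sub>\<beta>\<close>; its energy is then below both
  maxima, and as \<open>H\<close> increases with \<open>\<bar>W\<bar>\<close> it cannot cross the lines \<open>\<theta> = \<theta>1\<close>, \<open>\<theta> = \<theta>2\<close>.

  Conversely, such an orbit is trapped in the strip between these lines. It meets the axis at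
  arbitrarily large times, since otherwise \<open>\<theta>\<close> is eventually monotone and the orbit converges to an
  equilibrium, which has the wrong energy. The system is reversible under \<open>(t, W) \<mapsto> (- t, - W)\<close>, so
  two zeros of \<open>W\<close> give a period. The extrema of \<open>\<theta>\<close> lie on the axis, one on each side of \<open>\<theta>\<^sub>\<beta>\<close>, so
  the orbit is the whole level curve, which bounds a region around \<open>(\<theta>\<^sub>\<beta>, 0)\<close>.
\<close>

section \<open>Autonomous equations with a locally Lipschitz right-hand side\<close>

text \<open>A condition at a single point rather than on a set: closure rules then apply as plain
  introduction rules, with side conditions such as \<open>g p \<noteq> 0\<close> at that point
  only.\<close>

definition loc_lipschitz_at :: "'a::metric_space \<Rightarrow> ('a \<Rightarrow> 'b::metric_space) \<Rightarrow> bool" where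
  "loc_lipschitz_at p f \<longleftrightarrow> (\<exists>e>0. \<exists>K. K-lipschitz_on (ball p e) f)"

lemma loc_lipschitz_at_common:
  assumes "loc_lipschitz_at p f" "loc_lipschitz_at p g"
  obtains e K M where "0 < e" "K-lipschitz_on (ball p e) f" "M-lipschitz_on (ball p e) g"
proof -
  obtain e K e' M where *: "0 < e" "K-lipschitz_on (ball p e) f" "0 < e'" "M-lipschitz_on (ball p e') g"
    using assms unfolding loc_lipschitz_at_def by blast
  have "K-lipschitz_on (ball p (min e e')) f" "M-lipschitz_on (ball p (min e e')) g"
    by (auto intro: lipschitz_on_subset[OF *(2)] lipschitz_on_subset[OF *(4)])
  then show ?thesis
    using *(1,3) by (intro that[of "min e e'" K M]) auto
qed

section \<open>Closure rules for the local Lipschitz condition\<close>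

lemma loc_lipschitz_at_const: "loc_lipschitz_at p (\<lambda>x. c)"
  unfolding loc_lipschitz_at_def by (intro exI[of _ 1] exI[of _ 0] conjI lipschitz_onI) auto

lemma loc_lipschitz_at_fst: "loc_lipschitz_at p fst"
  unfolding loc_lipschitz_at_def
  by (intro exI[of _ 1] conjI lipschitz_onI) (auto simp: dist_fst_le)

lemma loc_lipschitz_at_snd: "loc_lipschitz_at p snd"
  unfolding loc_lipschitz_at_def
  by (intro exI[of _ 1] conjI lipschitz_onI) (auto simp: dist_snd_le)

lemma loc_lipschitz_at_add:
  fixes f g :: "'a::metric_space \<Rightarrow> 'b::real_normed_vector"
  assumes "loc_lipschitz_at p f" "loc_lipschitz_at p g"
  shows "loc_lipschitz_at p (\<lambda>x. f x + g x)"
  using loc_lipschitz_at_common[OF assms] lipschitz_on_add unfolding loc_lipschitz_at_def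
  by metis

lemma loc_lipschitz_at_diff:
  fixes f g :: "'a::metric_space \<Rightarrow> 'b::real_normed_vector"
  assumes "loc_lipschitz_at p f" "loc_lipschitz_at p g"
  shows "loc_lipschitz_at p (\<lambda>x. f x - g x)"
  using loc_lipschitz_at_common[OF assms] lipschitz_on_diff unfolding loc_lipschitz_at_def
  by metis

lemma loc_lipschitz_at_Pair:
  assumes "loc_lipschitz_at p f" "loc_lipschitz_at p g"
  shows "loc_lipschitz_at p (\<lambda>x. (f x, g x))"
  using loc_lipschitz_at_common[OF assms] lipschitz_on_Pair unfolding loc_lipschitz_at_def
  by metis

lemma loc_lipschitz_at_compose:
  assumes f: "loc_lipschitz_at p f" and g: "loc_lipschitz_at (f p) g"
  shows "loc_lipschitz_at p (\<lambda>x. g (f x))"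
proof -
  obtain e K where e: "0 < e" "K-lipschitz_on (ball p e) f"
    using f unfolding loc_lipschitz_at_def by blast
  obtain r M where r: "0 < r" "M-lipschitz_on (ball (f p) r) g"
    using g unfolding loc_lipschitz_at_def by blast
  have "continuous_on (ball p e) f" using e(2) by (rule lipschitz_on_continuous_on)
  then have "isCont f p"
    using e(1) by (auto simp: continuous_on_eq_continuous_at)
  then obtain s where s: "0 < s" "f ` ball p s \<subseteq> ball (f p) r"
    using r(1) unfolding continuous_at_ball by blast
  have "K-lipschitz_on (ball p (min e s)) f"
    by (rule lipschitz_on_subset[OF e(2)]) auto
  moreover have "M-lipschitz_on (f ` ball p (min e s)) g"
    by (rule lipschitz_on_subset[OF r(2)]) (use s in auto)
  ultimately have "(M * K)-lipschitz_on (ball p (min e s)) (g \<circ> f)"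
    by (rule lipschitz_on_compose)
  then show ?thesis
    unfolding loc_lipschitz_at_def comp_def using e(1) s(1) by (meson min_less_iff_conj)
qed

text \<open>Continuity of \<open>g'\<close> at \<open>y\<close> bounds it by
  \<open>\<bar>g' y\<bar> + 1\<close> on a small ball; the ball is convex, so this bound is a
  Lipschitz constant there.\<close>

lemma loc_lipschitz_at_C1:
  fixes g g' :: "real \<Rightarrow> real"
  assumes "eventually (\<lambda>y. (g has_real_derivative g' y) (at y)) (nhds y)" and "isCont g' y"
  shows "loc_lipschitz_at y g"
proof -
  obtain e where e: "0 < e" "\<And>z. dist z y < e \<Longrightarrow> (g has_real_derivative g' z) (at z)"
    using assms(1) unfolding eventually_nhds_metric by blast
  obtain r where r: "0 < r" "\<And>z. dist z y < r \<Longrightarrow> dist (g' z) (g' y) < 1"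
    using assms(2) unfolding continuous_at_eps_delta by (metis zero_less_one)
  define B where "B = \<bar>g' y\<bar> + 1"
  have "B-lipschitz_on (ball y (min e r)) g"
  proof (rule bounded_derivative_imp_lipschitz)
    fix z assume z: "z \<in> ball y (min e r)"
    then show "(g has_derivative (\<lambda>h. g' z * h)) (at z within ball y (min e r))"
      using e(2)[of z] by (simp add: has_field_derivative_def has_derivative_at_withinI dist_commute)
    have "\<bar>g' z\<bar> \<le> B" using r(2)[of z] z by (simp add: B_def dist_commute dist_real_def)
    then show "onorm (\<lambda>h. g' z * h) \<le> B"
      by (intro onorm_bound) (auto simp: abs_mult intro: mult_right_mono)
  qed (auto simp: B_def)
  then show ?thesis
    unfolding loc_lipschitz_at_def using e(1) r(1) by (meson min_less_iff_conj)
qed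

text \<open>Polarization writes the product as a difference of two squares, which reduces it to sums
  and one smooth function of a real variable.\<close>

lemma loc_lipschitz_at_mult:
  fixes f g :: "'a::metric_space \<Rightarrow> real"
  assumes "loc_lipschitz_at p f" "loc_lipschitz_at p g"
  shows "loc_lipschitz_at p (\<lambda>x. f x * g x)"
proof -
  have sq: "loc_lipschitz_at y (\<lambda>y. y\<^sup>2 / 4)" for y :: real
    by (rule loc_lipschitz_at_C1[where g' = "\<lambda>y. y / 2"])
       (auto intro!: always_eventually derivative_eq_intros continuous_intros)
  have "loc_lipschitz_at p (\<lambda>x. (f x + g x)\<^sup>2 / 4 - (f x - g x)\<^sup>2 / 4)"
    by (intro loc_lipschitz_at_diff loc_lipschitz_at_compose[OF _ sq] loc_lipschitz_at_add assms)
  moreover have "(\<lambda>x. (f x + g x)\<^sup>2 / 4 - (f x - g x)\<^sup>2 / 4) = (\<lambda>x. f x * g x)"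
    by (rule ext) (simp add: power2_eq_square field_simps)
  ultimately show ?thesis by simp
qed

lemma loc_lipschitz_at_sin: "loc_lipschitz_at y (sin :: real \<Rightarrow> real)"
  by (rule loc_lipschitz_at_C1[where g' = cos])
     (auto intro!: always_eventually derivative_eq_intros continuous_intros)

lemma loc_lipschitz_at_cos: "loc_lipschitz_at y (cos :: real \<Rightarrow> real)"
  by (rule loc_lipschitz_at_C1[where g' = "\<lambda>y. - sin y"])
     (auto intro!: always_eventually derivative_eq_intros continuous_intros)

lemma loc_lipschitz_at_inverse:
  fixes y :: real
  assumes "y \<noteq> 0"
  shows "loc_lipschitz_at y inverse"
proof (rule loc_lipschitz_at_C1)
  have "eventually (\<lambda>z. z \<in> - {0}) (nhds y)"
    using assms by (intro eventually_nhds_in_open) auto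
  then show "eventually (\<lambda>z. (inverse has_real_derivative - (inverse z ^ 2)) (at z)) (nhds y)"
    by eventually_elim (auto intro!: derivative_eq_intros simp: power2_eq_square)
qed (use assms in \<open>auto intro!: continuous_intros\<close>)

lemma loc_lipschitz_at_powr:
  fixes y a :: real
  assumes "0 < y"
  shows "loc_lipschitz_at y (\<lambda>y. y powr a)"
proof (rule loc_lipschitz_at_C1)
  have "eventually (\<lambda>z. z \<in> {0<..}) (nhds y)"
    using assms by (intro eventually_nhds_in_open) auto
  then show "eventually (\<lambda>z. ((\<lambda>y. y powr a) has_real_derivative a * z powr (a - 1)) (at z)) (nhds y)"
    by eventually_elim (auto intro!: derivative_eq_intros simp: powr_diff)
qed (use assms in \<open>auto intro!: continuous_intros\<close>)

lemma loc_lipschitz_at_divide: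
  fixes f g :: "'a::metric_space \<Rightarrow> real"
  assumes "loc_lipschitz_at p f" "loc_lipschitz_at p g" "g p \<noteq> 0"
  shows "loc_lipschitz_at p (\<lambda>x. f x / g x)"
  unfolding divide_inverse
  by (intro loc_lipschitz_at_mult assms loc_lipschitz_at_compose[of p g inverse] loc_lipschitz_at_inverse)

lemma loc_lipschitz_at_isCont:
  assumes "loc_lipschitz_at p f"
  shows "isCont f p"
proof -
  obtain e K where e: "0 < e" "K-lipschitz_on (ball p e) f"
    using assms unfolding loc_lipschitz_at_def by blast
  have "continuous_on (ball p e) f" using e(2) by (rule lipschitz_on_continuous_on)
  then show ?thesis
    using e(1) by (auto simp: continuous_on_eq_continuous_at)
qed

text \<open>The set of times at which the solutions agree is closed by continuity and open by a
  Gronwall estimate, hence everything. Near a common value both solutions lie in the ball on which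
  \<open>f\<close> is Lipschitz.\<close>

lemma autonomous_ode_unique:
  fixes f :: "'a::real_inner \<Rightarrow> 'a"
  assumes x: "\<And>t. (x has_vector_derivative f (x t)) (at t)"
    and y: "\<And>t. (y has_vector_derivative f (y t)) (at t)"
    and lip: "\<And>t. loc_lipschitz_at (x t) f"
    and init: "x t0 = y t0"
  shows "x t = y t"
proof -
  have contx: "isCont x t" and conty: "isCont y t" for t
    using x y by (auto intro: has_vector_derivative_continuous)
  define S where "S = {t. x t = y t}"
  have "closed S"
    unfolding S_def using contx conty
    by (intro closed_Collect_eq) (auto simp: continuous_on_eq_continuous_at)
  moreover have "open S"
    unfolding open_dist
  proof
    fix t1 assume "t1 \<in> S"
    then have eq: "x t1 = y t1" by (simp add: S_def)
    obtain e K where e: "0 < e" and K: "K-lipschitz_on (ball (x t1) e) f"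
      using lip[of t1] unfolding loc_lipschitz_at_def by blast
    obtain r where r: "0 < r" "x ` ball t1 r \<subseteq> ball (x t1) e"
      using contx[of t1] e unfolding continuous_at_ball by blast
    obtain s where s: "0 < s" "y ` ball t1 s \<subseteq> ball (x t1) e"
      using conty[of t1] e unfolding continuous_at_ball eq by blast
    \<comment> \<open>The squared distance of the solutions; unlike the norm it is differentiable
      where it vanishes.\<close>
    define q where "q t = (x t - y t) \<bullet> (x t - y t)" for t
    define q' where "q' t = 2 * ((x t - y t) \<bullet> (f (x t) - f (y t)))" for t
    have dq: "(q has_real_derivative q' t) (at t)" for t
      unfolding q_def q'_def has_real_derivative_iff_has_vector_derivative
      using bounded_bilinear.has_vector_derivative[OF bounded_bilinear_inner
          has_vector_derivative_diff[OF x[of t] y[of t]] has_vector_derivative_diff[OF x[of t] y[of t]]]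
      by (simp add: inner_commute)
    have dexp: "((\<lambda>u. exp (c * u) * q u) has_real_derivative exp (c * u) * (q' u + c * q u)) (at u)" for c u
    proof -
      have "((\<lambda>u. exp (c * u)) has_real_derivative exp (c * u) * c) (at u)"
        by (auto intro!: derivative_eq_intros)
      from DERIV_mult[OF this dq[of u]] show ?thesis by (simp add: algebra_simps)
    qed
    have bound: "\<bar>q' t\<bar> \<le> 2 * K * q t" if "dist t t1 < min r s" for t
    proof -
      have "x t \<in> ball (x t1) e" "y t \<in> ball (x t1) e"
        using r(2) s(2) that by (auto simp: dist_commute image_subset_iff)
      then have "norm (f (x t) - f (y t)) \<le> K * norm (x t - y t)"
        using lipschitz_onD[OF K] by (simp add: dist_norm)
      then have "norm (x t - y t) * norm (f (x t) - f (y t)) \<le> norm (x t - y t) * (K * norm (x t - y t))"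
        by (rule mult_left_mono) simp
      also have "\<dots> = K * q t"
        unfolding q_def dot_square_norm power2_eq_square by simp
      finally have "\<bar>(x t - y t) \<bullet> (f (x t) - f (y t))\<bar> \<le> K * q t"
        by (rule order_trans[OF Cauchy_Schwarz_ineq2])
      then show ?thesis
        unfolding q'_def abs_mult by simp
    qed
    have "t \<in> S" if t: "dist t t1 < min r s" for t
    proof -
      have "q t \<le> 0"
      proof (cases "t1 \<le> t")
        case True
        \<comment> \<open>The integrating factor turns \<open>q' \<le> 2 * K * q\<close> into a
          monotone quantity that vanishes at \<open>t1\<close>. Backwards in time the lower bound on
          \<open>q'\<close> is used, with the opposite sign in the exponent.\<close>
        have "exp (- 2 * K * t) * q t \<le> exp (- 2 * K * t1) * q t1"
        proof (rule DERIV_nonpos_imp_nonincreasing[OF True], intro exI conjI)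
          fix u assume "t1 \<le> u" "u \<le> t"
          then have u: "q' u \<le> 2 * K * q u" using bound[of u] t by (auto simp: dist_real_def)
          show "((\<lambda>u. exp (- 2 * K * u) * q u) has_real_derivative
              exp (- 2 * K * u) * (q' u - 2 * K * q u)) (at u)"
            using dexp[of "- 2 * K" u] by simp
          show "exp (- 2 * K * u) * (q' u - 2 * K * q u) \<le> 0"
            using u by (simp add: mult_nonneg_nonpos)
        qed
        then show ?thesis by (simp add: q_def[of t1] eq mult_le_0_iff)
      next
        case False
        then have le: "t \<le> t1" by simp
        have "exp (2 * K * t) * q t \<le> exp (2 * K * t1) * q t1"
        proof (rule DERIV_nonneg_imp_nondecreasing[OF le], intro exI conjI)
          fix u assume "t \<le> u" "u \<le> t1"
          then have u: "- q' u \<le> 2 * K * q u" using bound[of u] t by (auto simp: dist_real_def)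
          show "((\<lambda>u. exp (2 * K * u) * q u) has_real_derivative
              exp (2 * K * u) * (q' u + 2 * K * q u)) (at u)"
            by (rule dexp)
          show "0 \<le> exp (2 * K * u) * (q' u + 2 * K * q u)"
            using u by simp
        qed
        then show ?thesis by (simp add: q_def[of t1] eq mult_le_0_iff)
      qed
      then have "x t - y t = 0"
        using inner_ge_zero[of "x t - y t"] by (metis q_def inner_eq_zero_iff order_antisym)
      then show ?thesis by (simp add: S_def)
    qed
    then show "\<exists>e>0. \<forall>t. dist t t1 < e \<longrightarrow> t \<in> S"
      using r(1) s(1) by (meson min_less_iff_conj)
  qed
  moreover have "S \<noteq> {}" using init by (auto simp: S_def)
  ultimately have "S = UNIV" using clopen[of S] by simp
  then show ?thesis by (auto simp: S_def)
qed

text \<open>If \<open>f p\<close> were nonzero, the component of \<open>x\<close> along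
  \<open>f p\<close> would eventually have derivative at least half of
  \<open>f p \<bullet> f p\<close>, so its increments over unit time could not tend to 0.\<close>

lemma ode_limit_is_equilibrium:
  fixes f :: "'a::real_inner \<Rightarrow> 'a"
  assumes x: "\<And>t. (x has_vector_derivative f (x t)) (at t)"
    and lim: "(x \<longlongrightarrow> p) at_top" and f: "isCont f p"
  shows "f p = 0"
proof (rule ccontr)
  assume nz: "f p \<noteq> 0"
  define c where "c = f p \<bullet> f p"
  have c: "0 < c" using nz by (simp add: c_def)
  define g where "g t = x t \<bullet> f p" for t
  have dg: "(g has_real_derivative f (x t) \<bullet> f p) (at t)" for t
    unfolding g_def has_real_derivative_iff_has_vector_derivative
    using x[of t] unfolding has_vector_derivative_def
    by (auto intro!: derivative_eq_intros)
  have "((\<lambda>t. f (x t) \<bullet> f p) \<longlongrightarrow> c) at_top"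
    unfolding c_def by (intro tendsto_intros isCont_tendsto_compose[OF f] lim)
  then have "eventually (\<lambda>t. c / 2 < f (x t) \<bullet> f p) at_top"
    using c by (intro order_tendstoD(1)) auto
  then obtain T where T: "\<And>t. T \<le> t \<Longrightarrow> c / 2 < f (x t) \<bullet> f p"
    unfolding eventually_at_top_linorder by blast
  have "(g \<longlongrightarrow> p \<bullet> f p) at_top" unfolding g_def by (intro tendsto_intros lim)
  moreover have "filterlim (\<lambda>t::real. t + 1) at_top at_top"
    by (subst add.commute) (intro filterlim_tendsto_add_at_top[OF tendsto_const] filterlim_ident)
  ultimately have "((\<lambda>t. g (t + 1) - g t) \<longlongrightarrow> p \<bullet> f p - p \<bullet> f p) at_top"
    by (intro tendsto_diff) (rule filterlim_compose[of g])
  then have "eventually (\<lambda>t. g (t + 1) - g t < c / 2) at_top"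
    using c by (intro order_tendstoD(2)) auto
  then obtain T' where T': "\<And>t. T' \<le> t \<Longrightarrow> g (t + 1) - g t < c / 2"
    unfolding eventually_at_top_linorder by blast
  define s where "s = max T T'"
  obtain z where "s < z" "z < s + 1" "g (s + 1) - g s = (s + 1 - s) * (f (x z) \<bullet> f p)"
    using MVT2[of s "s + 1" g "\<lambda>t. f (x t) \<bullet> f p"] dg by auto
  then show False
    using T[of z] T'[of s] by (auto simp: s_def)
qed

section \<open>The Hamiltonian\<close>

locale vortex_pair =
  fixes \<alpha> \<beta> d :: real
  assumes \<alpha>: "0 < \<alpha>" and d: "0 < d" and \<beta>: "1 \<le> \<beta>"
begin

text \<open>Working with \<open>b\<close> turns the fractional powers of \<beta> into integer
  powers, which polynomial reasoning can handle.\<close>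

definition b where "b = sqrt \<beta>"
abbreviation \<theta>\<^sub>\<beta> where "\<theta>\<^sub>\<beta> \<equiv> theta_beta \<beta>"
definition k where "k \<theta> = b * sin \<theta> - cos \<theta>"
definition m where "m \<theta> = sin \<theta> + b * cos \<theta>"
text \<open>The difference of the two filament radii is \<open>d / b * k \<theta>\<close>, so this
  is the distance between the filaments in a meridian half-plane.\<close>

definition rad where "rad \<theta> W = sqrt ((d / b * k \<theta>)\<^sup>2 + W\<^sup>2)"
definition L where
  "L \<theta> = (b ^ 3 * (ln (1 - sin \<theta>) - ln (1 + sin \<theta>)) + ln (1 - cos \<theta>) - ln (1 + cos \<theta>)) / (2 * d)"
definition L' where "L' \<theta> = (1 / sin \<theta> - b ^ 3 / cos \<theta>) / d"
text \<open>Agrees with \<open>Ham\<close> on \<open>Omega \<beta>\<close>. As \<open>W\<close>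
  enters only through \<open>rad\<close>, a level of \<open>H\<close> at fixed \<theta> amounts to a
  value of \<open>rad\<close>.\<close>

definition H where "H \<theta> W = L \<theta> - \<alpha> * b / rad \<theta> W"
definition G where "G \<theta> = F2 \<alpha> \<beta> d \<theta> 0"

lemma b: "1 \<le> b" "0 < b"
  using \<beta> by (auto simp: b_def)

lemma \<beta>_powr: "\<beta> powr (3/2) = b ^ 3"
proof -
  have "\<beta> powr (3/2) = (\<beta> powr (1/2)) powr 3" by (simp add: powr_powr)
  then show ?thesis using b by (simp add: powr_half_sqrt \<beta>[THEN order_trans[OF zero_le_one]] b_def)
qed

lemma trig_pos:
  assumes "0 < \<theta>" "\<theta> < pi / 2"
  shows "0 < sin \<theta>" "0 < cos \<theta>" "sin \<theta> < 1" "cos \<theta> < 1"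
proof -
  show s: "0 < sin \<theta>" and c: "0 < cos \<theta>"
    using assms by (auto intro: sin_gt_zero2 cos_gt_zero)
  show "sin \<theta> < 1" "cos \<theta> < 1"
    using sin_monotone_2pi[of \<theta> "pi/2"] cos_monotone_0_pi[of 0 \<theta>] assms by auto
qed

lemma theta_beta: "0 < \<theta>\<^sub>\<beta>" "\<theta>\<^sub>\<beta> < pi / 2" "k \<theta>\<^sub>\<beta> = 0"
  using b arctan_ubound unfolding theta_beta_def k_def b_def
  by (auto simp: sin_arctan cos_arctan)

section \<open>Signs and monotonicity of \<open>k\<close> and \<open>m\<close>\<close>

lemma k_strict_mono:
  assumes "0 \<le> x" "x < y" "y \<le> pi / 2"
  shows "k x < k y"
proof -
  have "sin x < sin y" using assms by (intro sin_monotone_2pi) auto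
  moreover have "cos y < cos x" using assms pi_ge_two by (intro cos_monotone_0_pi) auto
  ultimately show ?thesis using b unfolding k_def by (smt (verit) mult_less_cancel_left_pos)
qed

lemma k_neg: "0 < \<theta> \<Longrightarrow> \<theta> < \<theta>\<^sub>\<beta> \<Longrightarrow> k \<theta> < 0"
  using k_strict_mono[of \<theta> \<theta>\<^sub>\<beta>] theta_beta by simp

lemma k_pos: "\<theta>\<^sub>\<beta> < \<theta> \<Longrightarrow> \<theta> < pi / 2 \<Longrightarrow> 0 < k \<theta>"
  using k_strict_mono[of \<theta>\<^sub>\<beta> \<theta>] theta_beta by simp

lemma k_nz: "0 < \<theta> \<Longrightarrow> \<theta> < pi / 2 \<Longrightarrow> \<theta> \<noteq> \<theta>\<^sub>\<beta> \<Longrightarrow> k \<theta> \<noteq> 0"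
  using k_neg k_pos by (metis less_irrefl linorder_neqE_linordered_idom)

lemma m_pos: "0 < \<theta> \<Longrightarrow> \<theta> < pi / 2 \<Longrightarrow> 0 < m \<theta>"
  using trig_pos b unfolding m_def by (simp add: add_pos_pos)

lemma DERIV_k: "(k has_real_derivative m \<theta>) (at \<theta>)"
  unfolding k_def m_def by (auto intro!: derivative_eq_intros)

lemma DERIV_m: "(m has_real_derivative - k \<theta>) (at \<theta>)"
  unfolding k_def m_def by (auto intro!: derivative_eq_intros)

text \<open>The derivative of \<open>m\<close> is \<open>- k\<close>, so \<open>m\<close> increases
  up to \<open>\<theta>\<^sub>\<beta>\<close> and decreases afterwards. This makes
  \<open>m / k^2\<close> monotone on each side.\<close>

lemma m_strict_mono_left: "0 < x \<Longrightarrow> x < y \<Longrightarrow> y < \<theta>\<^sub>\<beta> \<Longrightarrow> m x < m y"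
  by (rule DERIV_pos_imp_increasing) (use DERIV_m k_neg in force)+

lemma m_strict_antimono_right: "\<theta>\<^sub>\<beta> < x \<Longrightarrow> x < y \<Longrightarrow> y < pi / 2 \<Longrightarrow> m y < m x"
  by (rule DERIV_neg_imp_decreasing) (use DERIV_m k_pos in force)+

lemma Omega_iff: "(\<theta>, W) \<in> Omega \<beta> \<longleftrightarrow> 0 < \<theta> \<and> \<theta> < pi / 2 \<and> (\<theta> \<noteq> \<theta>\<^sub>\<beta> \<or> W \<noteq> 0)"
  by (auto simp: Omega_def)

lemma rad_pos:
  assumes "(\<theta>, W) \<in> Omega \<beta>"
  shows "0 < rad \<theta> W"
proof -
  have "k \<theta> \<noteq> 0 \<or> W \<noteq> 0" using assms k_nz by (auto simp: Omega_iff)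
  then show ?thesis
    unfolding rad_def using b d by (auto simp: add_pos_nonneg add_nonneg_pos)
qed

lemma rad_nonneg: "0 \<le> rad \<theta> W"
  unfolding rad_def by simp

lemma Dbeta_eq: "Dbeta \<beta> d \<theta> W = (rad \<theta> W)\<^sup>2"
  unfolding Dbeta_def rad_def k_def b_def using \<beta>
  by (simp add: power_mult_distrib power_divide)

lemma rad_axis: "rad \<theta> 0 = d / b * \<bar>k \<theta>\<bar>"
  unfolding rad_def using b d by (simp add: abs_mult)

lemma Dbeta_powr:
  assumes "(\<theta>, W) \<in> Omega \<beta>"
  shows "Dbeta \<beta> d \<theta> W powr (3/2) = rad \<theta> W ^ 3"
proof -
  have "rad \<theta> W ^ 2 = rad \<theta> W powr 2" "rad \<theta> W powr 3 = rad \<theta> W ^ 3"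
    using rad_pos[OF assms] by simp_all
  then show ?thesis by (simp add: Dbeta_eq powr_powr)
qed

lemma F1_eq: "(\<theta>, W) \<in> Omega \<beta> \<Longrightarrow> F1 \<alpha> \<beta> d \<theta> W = \<alpha> * b * W / rad \<theta> W ^ 3"
  by (simp add: F1_def Dbeta_powr b_def)

text \<open>The two terms are minus the \<theta>-derivatives of the two terms of
  \<open>H\<close>.\<close>

lemma F2_eq:
  assumes "(\<theta>, W) \<in> Omega \<beta>"
  shows "F2 \<alpha> \<beta> d \<theta> W = - L' \<theta> - \<alpha> * b * (d / b)\<^sup>2 * k \<theta> * m \<theta> / rad \<theta> W ^ 3"
proof -
  have "0 < sin \<theta>" "0 < cos \<theta>" using trig_pos assms by (auto simp: Omega_iff)
  moreover have "0 < rad \<theta> W" using rad_pos[OF assms] .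
  ultimately show ?thesis
    using b d unfolding F2_def Dbeta_powr[OF assms] \<beta>_powr b_def[symmetric] L'_def
    by (simp add: k_def m_def divide_simps) algebra
qed

lemma Ham_eq:
  assumes "(\<theta>, W) \<in> Omega \<beta>"
  shows "Ham \<alpha> \<beta> d \<theta> W = H \<theta> W"
proof -
  have *: "0 < sin \<theta>" "0 < cos \<theta>" "sin \<theta> < 1" "cos \<theta> < 1"
    using trig_pos assms by (auto simp: Omega_iff)
  have "sqrt (Dbeta \<beta> d \<theta> W) = rad \<theta> W"
    using rad_nonneg by (simp add: Dbeta_eq)
  then show ?thesis
    using * unfolding Ham_def H_def L_def \<beta>_powr b_def[symmetric]
    by (simp add: ln_mult ln_div ln_powr) (simp add: algebra_simps)
qed

lemma DERIV_L:
  assumes "0 < \<theta>" "\<theta> < pi / 2"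
  shows "(L has_real_derivative L' \<theta>) (at \<theta>)"
proof -
  note t = trig_pos[OF assms]
  have c: "(cos \<theta>)\<^sup>2 = (1 - sin \<theta>) * (1 + sin \<theta>)"
    by (simp add: cos_squared_eq power2_eq_square algebra_simps)
  have s: "(sin \<theta>)\<^sup>2 = (1 - cos \<theta>) * (1 + cos \<theta>)"
    by (simp add: sin_squared_eq power2_eq_square algebra_simps)
  have cs: "(cos \<theta>)\<^sup>2 + (sin \<theta>)\<^sup>2 = 1" by simp
  \<comment> \<open>Pairing the factors \<open>1 - sin \<theta>\<close> and
    \<open>1 + sin \<theta>\<close> gives the denominator \<open>(cos \<theta>)\<^sup>2\<close>, and
    a factor \<open>cos \<theta>\<close> cancels.\<close>
  have 1: "- cos \<theta> / (1 - sin \<theta>) - cos \<theta> / (1 + sin \<theta>) = - 2 / cos \<theta>"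
    using t c cs by (simp add: divide_simps) algebra
  have 2: "sin \<theta> / (1 - cos \<theta>) + sin \<theta> / (1 + cos \<theta>) = 2 / sin \<theta>"
    using t s cs by (simp add: divide_simps) algebra
  have "(L has_real_derivative (b ^ 3 * (- cos \<theta> / (1 - sin \<theta>) - cos \<theta> / (1 + sin \<theta>))
      + (sin \<theta> / (1 - cos \<theta>) + sin \<theta> / (1 + cos \<theta>))) / (2 * d)) (at \<theta>)"
    unfolding L_def
    by (intro DERIV_cdivide) (use t in \<open>auto intro!: derivative_eq_intros simp: algebra_simps\<close>)
  moreover have "(b ^ 3 * (- 2 / cos \<theta>) + 2 / sin \<theta>) / (2 * d) = L' \<theta>"
    unfolding L'_def using d by (simp add: diff_divide_distrib)
  ultimately show ?thesis
    unfolding 1 2 by simp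
qed

text \<open>Stated along an arbitrary curve to serve twice: along a solution the derivative cancels
  to 0, along the axis it is \<open>- G\<close>.\<close>

lemma DERIV_H:
  assumes u: "(u has_real_derivative u') (at t)" and w: "(w has_real_derivative w') (at t)"
    and \<Omega>: "(u t, w t) \<in> Omega \<beta>"
  shows "((\<lambda>t. H (u t) (w t)) has_real_derivative
    F1 \<alpha> \<beta> d (u t) (w t) * w' - F2 \<alpha> \<beta> d (u t) (w t) * u') (at t)"
proof -
  let ?r = "rad (u t) (w t)"
  have r: "0 < ?r" using rad_pos[OF \<Omega>] .
  then have r2: "0 < (d / b * k (u t))\<^sup>2 + (w t)\<^sup>2" unfolding rad_def by simp
  have dk: "((\<lambda>t. k (u t)) has_real_derivative m (u t) * u') (at t)"
    by (rule DERIV_chain2[OF DERIV_k u])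
  have dr: "((\<lambda>t. rad (u t) (w t)) has_real_derivative
      ((d / b)\<^sup>2 * k (u t) * m (u t) * u' + w t * w') / ?r) (at t)"
  proof -
    \<comment> \<open>The constant is generalized to \<open>e\<close> so that simplification does
      not expand \<open>d / b\<close>.\<close>
    have "((\<lambda>t. (e * k (u t))\<^sup>2 + (w t)\<^sup>2) has_real_derivative
        2 * (e\<^sup>2 * k (u t) * m (u t) * u' + w t * w')) (at t)" for e
      by (auto intro!: derivative_eq_intros dk w simp: algebra_simps power2_eq_square)
    from DERIV_chain2[OF DERIV_real_sqrt[OF r2] this[of "d / b"]] show ?thesis
      unfolding rad_def
      by (rule DERIV_cong) (simp only: divide_inverse inverse_mult_distrib mult_ac, simp)
  qed
  have dL: "((\<lambda>t. L (u t)) has_real_derivative L' (u t) * u') (at t)"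
    by (rule DERIV_chain2[OF DERIV_L u]) (use \<Omega> in \<open>auto simp: Omega_iff\<close>)
  have "((\<lambda>t. H (u t) (w t)) has_real_derivative L' (u t) * u' -
      (0 * ?r - \<alpha> * b * (((d / b)\<^sup>2 * k (u t) * m (u t) * u' + w t * w') / ?r)) / (?r * ?r)) (at t)"
    unfolding H_def using r by (intro DERIV_diff dL DERIV_divide DERIV_const dr) simp
  moreover have eq: "(0 * r - \<alpha> * b * ((e * k (u t) * m (u t) * u' + w t * w') / r)) / (r * r) =
      - (\<alpha> * b * w t / r ^ 3 * w' + \<alpha> * b * e * k (u t) * m (u t) / r ^ 3 * u')" for e r
    by (simp add: power3_eq_cube add_divide_distrib diff_divide_distrib distrib_left mult_ac)
  ultimately show ?thesis
    unfolding F1_eq[OF \<Omega>] F2_eq[OF \<Omega>]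
    by (elim DERIV_cong) (simp only: eq, simp add: left_diff_distrib)
qed

text \<open>At fixed \<theta> the distance \<open>rad\<close> is least on the axis, and
  \<open>H\<close> increases with it. The angle \<open>\<theta>\<^sub>\<beta>\<close> must be
  excluded: there \<open>rad\<close> is 0 on the axis, and division by 0 yields the value
  \<open>L \<theta>\<^sub>\<beta>\<close>, which is too large.\<close>

lemma H_le_axis:
  assumes "0 < \<theta>" "\<theta> < pi / 2" "\<theta> \<noteq> \<theta>\<^sub>\<beta>"
  shows "H \<theta> 0 \<le> H \<theta> W"
proof -
  have "0 < rad \<theta> 0" using assms by (intro rad_pos) (auto simp: Omega_iff)
  moreover have "rad \<theta> 0 \<le> rad \<theta> W" unfolding rad_def by (rule real_sqrt_le_mono) simp
  ultimately show ?thesis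
    unfolding H_def using \<alpha> b by (auto intro!: divide_left_mono)
qed

section \<open>The function \<open>G\<close> on the axis: monotonicity and zeros\<close>

lemma G_eq:
  assumes "0 < \<theta>" "\<theta> < pi / 2" "\<theta> \<noteq> \<theta>\<^sub>\<beta>"
  shows "G \<theta> = (b ^ 3 / cos \<theta> - 1 / sin \<theta> - sgn (k \<theta>) * (\<alpha> * b\<^sup>2 * m \<theta> / (k \<theta>)\<^sup>2)) / d"
proof -
  have nz: "k \<theta> \<noteq> 0" using k_nz assms by blast
  have \<Omega>: "(\<theta>, 0) \<in> Omega \<beta>" using assms by (simp add: Omega_iff)
  \<comment> \<open>On the axis \<open>rad\<close> is a multiple of
    \<open>\<bar>k \<theta>\<bar>\<close>, and \<open>k / \<bar>k\<bar>^3\<close> is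
    \<open>sgn k / k^2\<close>: the interaction term changes sign at
    \<open>\<theta>\<^sub>\<beta>\<close>.\<close>
  have "\<alpha> * b * (d / b)\<^sup>2 * k \<theta> * m \<theta> / (d / b * \<bar>k \<theta>\<bar>) ^ 3 = sgn (k \<theta>) * (\<alpha> * b\<^sup>2 * m \<theta> / (k \<theta>)\<^sup>2) / d"
    using nz b d by (cases "0 < k \<theta>") (simp_all add: field_simps power3_eq_cube power2_eq_square)
  then show ?thesis
    unfolding G_def F2_eq[OF \<Omega>] rad_axis L'_def using d by (simp add: field_simps)
qed

lemma sec_csc_strict_mono:
  assumes "0 < x" "x < y" "y < pi / 2"
  shows "b ^ 3 / cos x - 1 / sin x < b ^ 3 / cos y - 1 / sin y"
proof -
  have "sin x < sin y" using assms by (intro sin_monotone_2pi) auto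
  moreover have "cos y < cos x" using assms pi_ge_two by (intro cos_monotone_0_pi) auto
  moreover have "0 < sin x" "0 < cos y" using trig_pos assms by auto
  ultimately have "1 / sin y < 1 / sin x" "b ^ 3 / cos x < b ^ 3 / cos y"
    using b by (auto intro!: divide_strict_left_mono)
  then show ?thesis by simp
qed

text \<open>Here \<open>k\<close> is negative and the interaction term enters with a plus sign.
  Towards \<open>\<theta>\<^sub>\<beta>\<close> its numerator \<open>m\<close> grows and its
  denominator \<open>k^2\<close> shrinks, so both parts of \<open>G\<close> increase.\<close>

lemma G_strict_mono_left:
  assumes "0 < x" "x < y" "y < \<theta>\<^sub>\<beta>"
  shows "G x < G y"
proof -
  have kx: "k x < k y" "k y < 0"
    using assms theta_beta k_strict_mono[of x y] k_neg[of y] by auto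
  then have "(k y)\<^sup>2 < (k x)\<^sup>2"
    using power_strict_mono[of "- k y" "- k x" 2] by simp
  moreover have "0 < m x" "m x < m y"
    using m_pos m_strict_mono_left assms theta_beta by auto
  ultimately have "m x / (k x)\<^sup>2 < m y / (k y)\<^sup>2"
    using kx by (intro frac_less) auto
  then have "\<alpha> * b\<^sup>2 * (m x / (k x)\<^sup>2) < \<alpha> * b\<^sup>2 * (m y / (k y)\<^sup>2)"
    using \<alpha> b by (intro mult_strict_left_mono) auto
  then show ?thesis
    using sec_csc_strict_mono[of x y] assms theta_beta kx d
    by (simp add: G_eq divide_strict_right_mono)
qed

text \<open>Now the interaction term enters with a minus sign, while \<open>m\<close> decreases and
  \<open>k^2\<close> increases, so again both parts of \<open>G\<close> increase.\<close>

lemma G_strict_mono_right: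
  assumes "\<theta>\<^sub>\<beta> < x" "x < y" "y < pi / 2"
  shows "G x < G y"
proof -
  have kx: "k x < k y" "0 < k x"
    using assms theta_beta k_strict_mono[of x y] k_pos[of x] by auto
  then have "(k x)\<^sup>2 < (k y)\<^sup>2" by (intro power_strict_mono) auto
  moreover have "0 < m y" "m y < m x"
    using m_pos m_strict_antimono_right assms theta_beta by auto
  ultimately have "m y / (k y)\<^sup>2 < m x / (k x)\<^sup>2"
    using kx by (intro frac_less) auto
  then have "\<alpha> * b\<^sup>2 * (m y / (k y)\<^sup>2) < \<alpha> * b\<^sup>2 * (m x / (k x)\<^sup>2)"
    using \<alpha> b by (intro mult_strict_left_mono) auto
  then show ?thesis
    using sec_csc_strict_mono[of x y] assms theta_beta kx d
    by (simp add: G_eq divide_strict_right_mono)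
qed

lemma G_zero_left: "\<exists>\<theta>>0. \<theta> < \<theta>\<^sub>\<beta> \<and> G \<theta> = 0"
proof -
  \<comment> \<open>\<open>P\<close> is \<open>G\<close> multiplied by the positive factor
    \<open>d * sin \<theta> * cos \<theta> * (k \<theta>)\<^sup>2\<close>. It is continuous up to
    both endpoints, where \<open>G\<close> is singular, so the intermediate value theorem
    applies.\<close>
  define P where "P \<theta> = (b ^ 3 * sin \<theta> - cos \<theta>) * (k \<theta>)\<^sup>2 + \<alpha> * b\<^sup>2 * sin \<theta> * cos \<theta> * m \<theta>" for \<theta>
  have P: "P 0 < 0" "0 < P \<theta>\<^sub>\<beta>"
    using theta_beta trig_pos[of \<theta>\<^sub>\<beta>] m_pos[of \<theta>\<^sub>\<beta>] \<alpha> b by (simp_all add: P_def k_def[of 0])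
  have "\<exists>\<theta>. 0 \<le> \<theta> \<and> \<theta> \<le> \<theta>\<^sub>\<beta> \<and> P \<theta> = 0"
    by (rule IVT) (use P theta_beta in \<open>auto simp: P_def k_def m_def intro!: continuous_intros\<close>)
  then obtain \<theta> where "0 \<le> \<theta>" "\<theta> \<le> \<theta>\<^sub>\<beta>" "P \<theta> = 0" by blast
  moreover from this have "\<theta> \<noteq> 0" "\<theta> \<noteq> \<theta>\<^sub>\<beta>" using P by auto
  ultimately have \<theta>: "0 < \<theta>" "\<theta> < \<theta>\<^sub>\<beta>" "P \<theta> = 0" by auto
  have "G \<theta> = P \<theta> / (d * sin \<theta> * cos \<theta> * (k \<theta>)\<^sup>2)"
    using \<theta> theta_beta k_neg[of \<theta>] trig_pos[of \<theta>] d
    by (simp add: G_eq P_def divide_simps) (simp add: mult_ac)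
  then show ?thesis using \<theta> by auto
qed

lemma G_zero_right: "\<exists>\<theta>>\<theta>\<^sub>\<beta>. \<theta> < pi / 2 \<and> G \<theta> = 0"
proof -
  \<comment> \<open>Again \<open>G\<close> with its denominators cleared; the sign of the second
    term is that of the region where \<open>k\<close> is positive.\<close>
  define P where "P \<theta> = (b ^ 3 * sin \<theta> - cos \<theta>) * (k \<theta>)\<^sup>2 - \<alpha> * b\<^sup>2 * sin \<theta> * cos \<theta> * m \<theta>" for \<theta>
  have P: "P \<theta>\<^sub>\<beta> < 0" "0 < P (pi / 2)"
    using theta_beta trig_pos[of \<theta>\<^sub>\<beta>] m_pos[of \<theta>\<^sub>\<beta>] \<alpha> b
    by (simp_all add: P_def k_def[of "pi / 2"])
  have "\<exists>\<theta>. \<theta>\<^sub>\<beta> \<le> \<theta> \<and> \<theta> \<le> pi / 2 \<and> P \<theta> = 0"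
    by (rule IVT) (use P theta_beta in \<open>auto simp: P_def k_def m_def intro!: continuous_intros\<close>)
  then obtain \<theta> where "\<theta>\<^sub>\<beta> \<le> \<theta>" "\<theta> \<le> pi / 2" "P \<theta> = 0" by blast
  moreover from this have "\<theta> \<noteq> pi / 2" "\<theta> \<noteq> \<theta>\<^sub>\<beta>" using P by (metis less_irrefl)+
  ultimately have \<theta>: "\<theta>\<^sub>\<beta> < \<theta>" "\<theta> < pi / 2" "P \<theta> = 0" by auto
  have "G \<theta> = P \<theta> / (d * sin \<theta> * cos \<theta> * (k \<theta>)\<^sup>2)"
    using \<theta> theta_beta k_pos[of \<theta>] trig_pos[of \<theta>] d
    by (simp add: G_eq P_def divide_simps)
  then show ?thesis using \<theta> by auto
qed

lemma loc_lipschitz_VF: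
  assumes "p \<in> Omega \<beta>"
  shows "loc_lipschitz_at p (VF \<alpha> \<beta> d)"
proof -
  obtain \<theta> W where p: "p = (\<theta>, W)" by fastforce
  have "0 < Dbeta \<beta> d (fst p) (snd p)"
    using rad_pos[of \<theta> W] assms by (simp add: p Dbeta_eq)
  moreover have "0 < sin (fst p)" "0 < cos (fst p)"
    using trig_pos assms by (auto simp: p Omega_iff)
  moreover from calculation(1)
  have "loc_lipschitz_at p (\<lambda>p. Dbeta \<beta> d (fst p) (snd p) powr (3 / 2))"
    unfolding Dbeta_def power2_eq_square
    by (intro loc_lipschitz_at_compose[OF _ loc_lipschitz_at_powr] loc_lipschitz_at_add loc_lipschitz_at_diff
        loc_lipschitz_at_mult loc_lipschitz_at_const loc_lipschitz_at_fst loc_lipschitz_at_snd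
        loc_lipschitz_at_compose[of _ fst, OF _ loc_lipschitz_at_sin]
        loc_lipschitz_at_compose[of _ fst, OF _ loc_lipschitz_at_cos])
  ultimately show ?thesis
    unfolding VF_def F1_def F2_def
    by (intro loc_lipschitz_at_Pair loc_lipschitz_at_divide loc_lipschitz_at_add loc_lipschitz_at_diff
        loc_lipschitz_at_mult loc_lipschitz_at_const loc_lipschitz_at_fst loc_lipschitz_at_snd
        loc_lipschitz_at_compose[of _ fst, OF _ loc_lipschitz_at_sin]
        loc_lipschitz_at_compose[of _ fst, OF _ loc_lipschitz_at_cos])
      (use b d \<beta> in \<open>auto simp: b_def\<close>)
qed

end

section \<open>Reversibility and equilibria\<close>

lemma bounded_mono_convergent_at_top:
  fixes f :: "real \<Rightarrow> real"
  assumes mono: "\<And>s t. T \<le> s \<Longrightarrow> s \<le> t \<Longrightarrow> f s \<le> f t" and B: "\<And>t. T \<le> t \<Longrightarrow> f t \<le> B"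
  shows "\<exists>p. (f \<longlongrightarrow> p) at_top"
proof
  let ?p = "SUP t\<in>{T..}. f t"
  have bdd: "bdd_above (f ` {T..})" using B unfolding bdd_above_def by auto
  show "(f \<longlongrightarrow> ?p) at_top"
  proof (rule order_tendstoI)
    fix a assume "a < ?p"
    then obtain s where "T \<le> s" "a < f s"
      using less_cSUP_iff[OF _ bdd, of a] by auto
    then have "a < f t" if "s \<le> t" for t using mono[of s t] that by simp
    then show "eventually (\<lambda>t. a < f t) at_top" unfolding eventually_at_top_linorder by blast
  next
    fix a assume a: "?p < a"
    have "f t < a" if "T \<le> t" for t
      using cSUP_upper[OF _ bdd, of t] that a by simp
    then show "eventually (\<lambda>t. f t < a) at_top" unfolding eventually_at_top_linorder by blast
  qed
qed

text \<open>By connectedness of the range. It keeps the angle of an orbit on one side of a vertical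
  line that the orbit never meets.\<close>

lemma continuous_avoids_imp_less:
  fixes f :: "real \<Rightarrow> real"
  assumes "continuous_on UNIV f" "\<And>t. f t \<noteq> c" "f s < c"
  shows "f t < c"
proof (rule ccontr)
  assume "\<not> f t < c"
  then have "c \<in> f ` UNIV"
    using connectedD_interval[OF connected_continuous_image[OF assms(1) connected_UNIV], of "f s" "f t" c]
      assms(3) by auto
  then show False using assms(2) by auto
qed

lemma continuous_avoids_imp_greater:
  fixes f :: "real \<Rightarrow> real"
  assumes "continuous_on UNIV f" "\<And>t. f t \<noteq> c" "c < f s"
  shows "c < f t"
  using continuous_avoids_imp_less[of "\<lambda>t. - f t" "- c" s t] assms
  by (auto intro: continuous_intros)

context vortex_pair begin

section \<open>The Hamiltonian on the axis, and time reversal\<close>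

lemma DERIV_H_axis:
  assumes "0 < \<theta>" "\<theta> < pi / 2" "\<theta> \<noteq> \<theta>\<^sub>\<beta>"
  shows "((\<lambda>\<theta>. H \<theta> 0) has_real_derivative - G \<theta>) (at \<theta>)"
  using DERIV_H[OF DERIV_ident DERIV_const, of \<theta> 0] assms by (simp add: Omega_iff G_def)

lemma H_axis_continuous_on:
  assumes "\<And>\<theta>. \<theta> \<in> S \<Longrightarrow> 0 < \<theta> \<and> \<theta> < pi / 2 \<and> \<theta> \<noteq> \<theta>\<^sub>\<beta>"
  shows "continuous_on S (\<lambda>\<theta>. H \<theta> 0)"
  using DERIV_H_axis assms
  by (intro continuous_at_imp_continuous_on ballI) (blast intro: DERIV_isCont)

text \<open>Reversing time negates both components of the velocity, and the reflection of
  \<open>W\<close> restores the second. This matches the vector field because \<open>F1\<close> is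
  odd and \<open>F2\<close> is even in \<open>W\<close>.\<close>

lemma is_solution_reflect:
  assumes "is_solution \<alpha> \<beta> d x"
  shows "is_solution \<alpha> \<beta> d (\<lambda>t. (fst (x (c - t)), - snd (x (c - t))))"
  unfolding is_solution_def
proof (intro allI conjI)
  fix t
  show "(fst (x (c - t)), - snd (x (c - t))) \<in> Omega \<beta>"
    using assms unfolding is_solution_def by (cases "x (c - t)") (metis Omega_iff fst_conv snd_conv neg_equal_0_iff_equal)
  have x: "(x has_vector_derivative VF \<alpha> \<beta> d (x (c - t))) (at (c - t))"
    using assms unfolding is_solution_def by blast
  have "((\<lambda>t. x (c - t)) has_vector_derivative (- 1) *\<^sub>R VF \<alpha> \<beta> d (x (c - t))) (at t)"
  proof -
    have "((\<lambda>t. c - t) has_vector_derivative - 1) (at t)"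
      unfolding has_vector_derivative_def by (auto intro!: derivative_eq_intros)
    from vector_diff_chain_at[OF this x] show ?thesis by (simp add: comp_def)
  qed
  then have x': "((\<lambda>t. x (c - t)) has_derivative (\<lambda>h. h *\<^sub>R (- VF \<alpha> \<beta> d (x (c - t))))) (at t)"
    by (simp add: has_vector_derivative_def)
  have "((\<lambda>t. (fst (x (c - t)), - snd (x (c - t)))) has_derivative
      (\<lambda>h. (fst (h *\<^sub>R (- VF \<alpha> \<beta> d (x (c - t)))), - snd (h *\<^sub>R (- VF \<alpha> \<beta> d (x (c - t))))))) (at t)"
    by (intro has_derivative_Pair has_derivative_minus has_derivative_fst has_derivative_snd x')
  moreover have "(fst (h *\<^sub>R (- VF \<alpha> \<beta> d q)), - snd (h *\<^sub>R (- VF \<alpha> \<beta> d q))) =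
      h *\<^sub>R VF \<alpha> \<beta> d (fst q, - snd q)" for h q
  proof -
    have "F1 \<alpha> \<beta> d \<theta> (- W) = - F1 \<alpha> \<beta> d \<theta> W" "F2 \<alpha> \<beta> d \<theta> (- W) = F2 \<alpha> \<beta> d \<theta> W" for \<theta> W
      by (simp_all add: F1_def F2_def Dbeta_def)
    then show ?thesis by (simp add: VF_def)
  qed
  ultimately show "((\<lambda>t. (fst (x (c - t)), - snd (x (c - t)))) has_vector_derivative
      VF \<alpha> \<beta> d (fst (x (c - t)), - snd (x (c - t)))) (at t)"
    by (simp add: has_vector_derivative_def)
qed

lemma is_solution_unique:
  assumes "is_solution \<alpha> \<beta> d x" "is_solution \<alpha> \<beta> d y" "x s = y s"
  shows "x t = y t"
  by (rule autonomous_ode_unique[of x "VF \<alpha> \<beta> d" y s])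
     (use assms loc_lipschitz_VF in \<open>auto simp: is_solution_def\<close>)

text \<open>With \<open>c = 2 * s\<close> the reflected solution takes the value \<open>x s\<close>
  at time \<open>s\<close> when \<open>W\<close> vanishes there, so uniqueness identifies the
  two.\<close>

lemma reflection_at_zero:
  assumes "is_solution \<alpha> \<beta> d x" "snd (x s) = 0"
  shows "x t = (fst (x (2 * s - t)), - snd (x (2 * s - t)))"
  using is_solution_unique[OF assms(1) is_solution_reflect[OF assms(1), of "2 * s"], of s t] assms(2)
  by (simp add: prod_eq_iff)

text \<open>Reflecting time about \<open>s\<close> and then about \<open>s'\<close> is the
  translation by \<open>2 * (s' - s)\<close>.\<close>

lemma periodic_if_two_zeros:
  assumes "is_solution \<alpha> \<beta> d x" "snd (x s) = 0" "snd (x s') = 0"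
  shows "x (t + 2 * (s' - s)) = x t"
proof -
  have "x (t + 2 * (s' - s)) = (fst (x (2 * s - t)), - snd (x (2 * s - t)))"
    using reflection_at_zero[OF assms(1,3), of "t + 2 * (s' - s)"] by (simp add: algebra_simps)
  then show ?thesis using reflection_at_zero[OF assms(1,2), of t] by simp
qed

end

section \<open>Equilibria and the shape of the Hamiltonian on the axis\<close>

locale vortex_equilibria = vortex_pair +
  fixes \<theta>1 \<theta>2
  assumes \<theta>1: "0 < \<theta>1" "\<theta>1 < theta_beta \<beta>" "G \<theta>1 = 0"
    and \<theta>2: "theta_beta \<beta> < \<theta>2" "\<theta>2 < pi / 2" "G \<theta>2 = 0"
begin

lemma equilibria: "{p \<in> Omega \<beta>. VF \<alpha> \<beta> d p = (0, 0)} = {(\<theta>1, 0), (\<theta>2, 0)}"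
proof (intro equalityI subsetI)
  fix p :: "real \<times> real" assume "p \<in> {p \<in> Omega \<beta>. VF \<alpha> \<beta> d p = (0, 0)}"
  then obtain \<theta> W where p: "p = (\<theta>, W)" "(\<theta>, W) \<in> Omega \<beta>" and F: "F1 \<alpha> \<beta> d \<theta> W = 0" "F2 \<alpha> \<beta> d \<theta> W = 0"
    by (cases p) (auto simp: VF_def)
  have W: "W = 0"
    using F(1) rad_pos[OF p(2)] \<alpha> b by (simp add: F1_eq[OF p(2)])
  then have "0 < \<theta>" "\<theta> < pi / 2" "\<theta> \<noteq> \<theta>\<^sub>\<beta>" "G \<theta> = 0"
    using p F(2) by (auto simp: Omega_iff G_def)
  then have "\<theta> = \<theta>1 \<or> \<theta> = \<theta>2"
    using G_strict_mono_left[of \<theta> \<theta>1] G_strict_mono_left[of \<theta>1 \<theta>]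
      G_strict_mono_right[of \<theta> \<theta>2] G_strict_mono_right[of \<theta>2 \<theta>] \<theta>1 \<theta>2
    by (metis less_irrefl linorder_neqE_linordered_idom)
  then show "p \<in> {(\<theta>1, 0), (\<theta>2, 0)}" using p W by auto
next
  fix p :: "real \<times> real" assume "p \<in> {(\<theta>1, 0), (\<theta>2, 0)}"
  then show "p \<in> {p \<in> Omega \<beta>. VF \<alpha> \<beta> d p = (0, 0)}"
    using \<theta>1 \<theta>2 theta_beta by (auto simp: VF_def F1_def G_def Omega_iff)
qed

text \<open>The derivative is \<open>- G\<close>, and \<open>G\<close> is positive between
  \<open>\<theta>1\<close> and \<open>\<theta>\<^sub>\<beta>\<close>. Since \<open>G\<close>
  vanishes at \<open>\<theta>1\<close> itself, the monotonicity rule is the one with conditions at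
  interior points only.\<close>

lemma H_axis_decreasing:
  assumes "\<theta>1 \<le> x" "x < y" "y < \<theta>\<^sub>\<beta>"
  shows "H y 0 < H x 0"
proof (rule DERIV_neg_imp_decreasing_open[OF assms(2)])
  show "\<exists>D. ((\<lambda>\<theta>. H \<theta> 0) has_real_derivative D) (at z) \<and> D < 0" if "x < z" "z < y" for z
    using that assms \<theta>1 theta_beta G_strict_mono_left[of \<theta>1 z]
    by (intro exI[of _ "- G z"] conjI DERIV_H_axis) auto
qed (use assms \<theta>1 theta_beta in \<open>auto intro!: H_axis_continuous_on\<close>)

lemma H_axis_increasing:
  assumes "\<theta>\<^sub>\<beta> < x" "x < y" "y \<le> \<theta>2"
  shows "H x 0 < H y 0"
proof (rule DERIV_pos_imp_increasing_open[OF assms(2)])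
  show "\<exists>D. ((\<lambda>\<theta>. H \<theta> 0) has_real_derivative D) (at z) \<and> 0 < D" if "x < z" "z < y" for z
    using that assms \<theta>2 theta_beta G_strict_mono_right[of z \<theta>2]
    by (intro exI[of _ "- G z"] conjI DERIV_H_axis) auto
qed (use assms \<theta>2 theta_beta in \<open>auto intro!: H_axis_continuous_on\<close>)

lemma H_axis_less_left:
  assumes "0 < \<theta>" "\<theta> < \<theta>\<^sub>\<beta>" "\<theta> \<noteq> \<theta>1"
  shows "H \<theta> 0 < H \<theta>1 0"
proof (cases "\<theta>1 < \<theta>")
  case False
  then have "\<theta> < \<theta>1" using assms by simp
  then show ?thesis
  proof (rule DERIV_pos_imp_increasing_open)
    show "\<exists>D. ((\<lambda>\<theta>. H \<theta> 0) has_real_derivative D) (at z) \<and> 0 < D" if "\<theta> < z" "z < \<theta>1" for z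
      using that assms \<theta>1 theta_beta G_strict_mono_left[of z \<theta>1]
      by (intro exI[of _ "- G z"] conjI DERIV_H_axis) auto
  qed (use assms \<theta>1 theta_beta in \<open>auto intro!: H_axis_continuous_on\<close>)
qed (use H_axis_decreasing assms in auto)

lemma H_axis_less_right:
  assumes "\<theta>\<^sub>\<beta> < \<theta>" "\<theta> < pi / 2" "\<theta> \<noteq> \<theta>2"
  shows "H \<theta> 0 < H \<theta>2 0"
proof (cases "\<theta> < \<theta>2")
  case False
  then have "\<theta>2 < \<theta>" using assms by simp
  then show ?thesis
  proof (rule DERIV_neg_imp_decreasing_open)
    show "\<exists>D. ((\<lambda>\<theta>. H \<theta> 0) has_real_derivative D) (at z) \<and> D < 0" if "\<theta>2 < z" "z < \<theta>" for z
      using that assms \<theta>2 theta_beta G_strict_mono_right[of \<theta>2 z]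
      by (intro exI[of _ "- G z"] conjI DERIV_H_axis) auto
  qed (use assms \<theta>2 theta_beta in \<open>auto intro!: H_axis_continuous_on\<close>)
qed (use H_axis_increasing assms in auto)

text \<open>At \<open>\<theta>1\<close> and \<open>\<theta>2\<close> the value of \<open>L\<close>
  exceeds that of \<open>H\<close>, hence \<open>E\<close>. Since \<open>L'\<close> is strictly
  decreasing, \<open>L\<close> is concave and cannot dip to \<open>E\<close> in between: a dip would
  give a negative slope followed by a positive one.\<close>

lemma L_greater:
  assumes \<theta>: "\<theta>1 \<le> \<theta>" "\<theta> \<le> \<theta>2" and E: "E \<le> H \<theta>1 0" "E \<le> H \<theta>2 0"
  shows "E < L \<theta>"
proof (rule ccontr)
  assume "\<not> E < L \<theta>"
  then have le: "L \<theta> \<le> E" by simp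
  have "0 < rad \<theta>1 0" "0 < rad \<theta>2 0"
    using \<theta>1 \<theta>2 theta_beta by (auto intro!: rad_pos simp: Omega_iff)
  then have "H \<theta>1 0 < L \<theta>1" "H \<theta>2 0 < L \<theta>2"
    unfolding H_def using \<alpha> b by auto
  then have less: "L \<theta> < L \<theta>1" "L \<theta> < L \<theta>2" using le E by auto
  then have lt: "\<theta>1 < \<theta>" "\<theta> < \<theta>2" using \<theta> by (auto simp: less_le)
  have D: "(L has_real_derivative L' z) (at z)" if "\<theta>1 \<le> z" "z \<le> \<theta>2" for z
    using that \<theta>1 \<theta>2 by (intro DERIV_L) auto
  obtain z where z: "\<theta>1 < z" "z < \<theta>" "L \<theta> - L \<theta>1 = (\<theta> - \<theta>1) * L' z"
    using MVT2[OF lt(1), of L L'] D lt by auto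
  obtain y where y: "\<theta> < y" "y < \<theta>2" "L \<theta>2 - L \<theta> = (\<theta>2 - \<theta>) * L' y"
    using MVT2[OF lt(2), of L L'] D lt by auto
  have "(\<theta> - \<theta>1) * L' z < 0" "0 < (\<theta>2 - \<theta>) * L' y"
    using z y less by auto
  then have "L' z < 0" "0 < L' y"
    using lt by (auto simp: mult_less_0_iff zero_less_mult_iff)
  moreover have "L' y < L' z"
    using sec_csc_strict_mono[of z y] z y \<theta>1 \<theta>2 d unfolding L'_def by (auto intro: divide_strict_right_mono)
  ultimately show False by simp
qed

end

section \<open>Orbits\<close>

locale vortex_solution = vortex_equilibria +
  fixes x
  assumes sol: "is_solution \<alpha> \<beta> d x"
begin

abbreviation th where "th t \<equiv> fst (x t)"
abbreviation w where "w t \<equiv> snd (x t)"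

lemma in_Omega: "(th t, w t) \<in> Omega \<beta>"
  using sol by (simp add: is_solution_def)

lemma th_bounds: "0 < th t" "th t < pi / 2"
  using in_Omega[of t] unfolding Omega_iff by auto

lemma DERIV_x: "(x has_vector_derivative VF \<alpha> \<beta> d (x t)) (at t)"
  using sol by (simp add: is_solution_def)

lemma DERIV_th: "(th has_real_derivative F1 \<alpha> \<beta> d (th t) (w t)) (at t)"
  using has_derivative_fst[OF DERIV_x[of t, unfolded has_vector_derivative_def]]
  by (simp add: VF_def has_field_derivative_def mult_commute_abs)

lemma DERIV_w: "(w has_real_derivative F2 \<alpha> \<beta> d (th t) (w t)) (at t)"
  using has_derivative_snd[OF DERIV_x[of t, unfolded has_vector_derivative_def]]
  by (simp add: VF_def has_field_derivative_def mult_commute_abs)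

lemma continuous_on_th: "continuous_on S th"
  using DERIV_th by (intro continuous_at_imp_continuous_on ballI DERIV_isCont)

lemma continuous_on_w: "continuous_on S w"
  using DERIV_w by (intro continuous_at_imp_continuous_on ballI DERIV_isCont)

definition E where "E = H (th 0) (w 0)"

lemma H_conserved: "H (th t) (w t) = E"
proof -
  have "((\<lambda>t. H (th t) (w t)) has_real_derivative 0) (at t)" for t
    using DERIV_H[OF DERIV_th DERIV_w in_Omega, of t] by (simp add: mult.commute)
  then show ?thesis unfolding E_def by (intro DERIV_isconst_all) blast
qed

lemma constant_if_equilibrium:
  assumes "VF \<alpha> \<beta> d (x s) = (0, 0)"
  shows "x t = x s"
proof -
  have "is_solution \<alpha> \<beta> d (\<lambda>_. x s)"
    using assms sol by (simp add: is_solution_def flip: zero_prod_def)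
  then show ?thesis using is_solution_unique[OF sol, of "\<lambda>_. x s" s t] by simp
qed

text \<open>On the lines through \<open>\<theta>1\<close> and \<open>\<theta>2\<close> the
  Hamiltonian is at least its axis value, which is above the conserved energy.\<close>

lemma stays_in_strip:
  assumes E: "E < H \<theta>1 0" "E < H \<theta>2 0"
  shows "\<theta>1 < th s \<Longrightarrow> \<theta>1 < th t" "th s < \<theta>2 \<Longrightarrow> th t < \<theta>2"
proof -
  have "th t \<noteq> \<theta>1" for t
    using H_le_axis[of \<theta>1 "w t"] H_conserved[of t] E \<theta>1 theta_beta by auto
  then show "\<theta>1 < th s \<Longrightarrow> \<theta>1 < th t"
    using continuous_avoids_imp_greater[OF continuous_on_th, of \<theta>1 s t] by auto
  have "th t \<noteq> \<theta>2" for t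
    using H_le_axis[of \<theta>2 "w t"] H_conserved[of t] E \<theta>2 theta_beta by auto
  then show "th s < \<theta>2 \<Longrightarrow> th t < \<theta>2"
    using continuous_avoids_imp_less[OF continuous_on_th, of \<theta>2 s t] by auto
qed

text \<open>Otherwise the copy of \<open>S\<close> on the axis would be a connected unbounded set in
  the complement of the orbit, contained in the component of
  \<open>(\<theta>\<^sub>\<beta>, 0)\<close>. It is applied to the two half-lines ending at
  \<open>\<theta>\<^sub>\<beta>\<close>.\<close>

lemma leapfrogging_meets_axis:
  assumes leap: "leapfrogging \<beta> x" and S: "connected S" "\<theta>\<^sub>\<beta> \<in> S" "\<not> bounded S"
  shows "\<exists>t. w t = 0 \<and> th t \<in> S"
proof (rule ccontr)
  assume no: "\<not> ?thesis"
  let ?R = "(\<lambda>\<theta>. (\<theta>, 0::real)) ` S"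
  have "connected ?R"
    using S by (intro connected_continuous_image continuous_intros)
  moreover have "?R \<subseteq> - range x"
  proof
    fix p assume p: "p \<in> ?R"
    show "p \<in> - range x"
    proof
      assume "p \<in> range x"
      then obtain t \<theta> where "x t = (\<theta>, 0)" "\<theta> \<in> S" using p by auto
      then have "w t = 0 \<and> th t \<in> S" by simp
      then show False using no by blast
    qed
  qed
  ultimately have "?R \<subseteq> connected_component_set (- range x) (\<theta>\<^sub>\<beta>, 0)"
    using S by (intro connected_component_maximal) auto
  then have "bounded ?R"
    using leap bounded_subset unfolding leapfrogging_def by blast
  then have "bounded (fst ` ?R)" by (rule bounded_fst)
  then show False using S by (simp add: image_image)
qed

lemma leapfrogging_imp_trapped:
  assumes leap: "leapfrogging \<beta> x"
  shows "\<theta>1 < th 0" "th 0 < \<theta>2" "E < H \<theta>1 0" "E < H \<theta>2 0"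
proof -
  have unbdd: "\<not> bounded {..\<theta>\<^sub>\<beta>}" "\<not> bounded {\<theta>\<^sub>\<beta>..}"
  proof -
    show "\<not> bounded {..\<theta>\<^sub>\<beta>}"
    proof
      assume "bounded {..\<theta>\<^sub>\<beta>}"
      then obtain B where "\<forall>y\<le>\<theta>\<^sub>\<beta>. \<bar>y\<bar> \<le> B" by (auto simp: bounded_iff)
      from this[rule_format, of "min \<theta>\<^sub>\<beta> (- B - 1)"] show False by linarith
    qed
    show "\<not> bounded {\<theta>\<^sub>\<beta>..}"
    proof
      assume "bounded {\<theta>\<^sub>\<beta>..}"
      then obtain B where "\<forall>y\<ge>\<theta>\<^sub>\<beta>. \<bar>y\<bar> \<le> B" by (auto simp: bounded_iff)
      from this[rule_format, of "max \<theta>\<^sub>\<beta> (B + 1)"] show False by linarith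
    qed
  qed
  obtain s where s: "w s = 0" "th s \<le> \<theta>\<^sub>\<beta>"
    using leapfrogging_meets_axis[OF leap, of "{..\<theta>\<^sub>\<beta>}"] unbdd by auto
  obtain s' where s': "w s' = 0" "\<theta>\<^sub>\<beta> \<le> th s'"
    using leapfrogging_meets_axis[OF leap, of "{\<theta>\<^sub>\<beta>..}"] unbdd by auto
  \<comment> \<open>Meeting an equilibrium would make the solution constant.\<close>
  have neq: "th t \<noteq> \<theta>\<^sub>\<beta>" "th t \<noteq> \<theta>1" "th t \<noteq> \<theta>2" if "w t = 0" for t
  proof -
    show "th t \<noteq> \<theta>\<^sub>\<beta>" using in_Omega[of t] that by (simp add: Omega_iff)
    have "x t \<notin> {(\<theta>1, 0), (\<theta>2, 0)}"
    proof
      assume "x t \<in> {(\<theta>1, 0), (\<theta>2, 0)}"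
      then have "VF \<alpha> \<beta> d (x t) = (0, 0)" using equilibria by blast
      then have "x u = x t" for u by (rule constant_if_equilibrium)
      then show False using leap unfolding leapfrogging_def by metis
    qed
    then show "th t \<noteq> \<theta>1" "th t \<noteq> \<theta>2" using that by (auto simp: prod_eq_iff)
  qed
  have left: "th s < \<theta>\<^sub>\<beta>" and right: "\<theta>\<^sub>\<beta> < th s'"
    using s s' neq(1)[of s] neq(1)[of s'] by simp_all
  show E: "E < H \<theta>1 0" "E < H \<theta>2 0"
    using H_conserved[of s] H_conserved[of s'] H_axis_less_left[of "th s"] H_axis_less_right[of "th s'"]
      left right th_bounds neq s s' by auto
  show "\<theta>1 < th 0" "th 0 < \<theta>2"
    using stays_in_strip[OF E] left right \<theta>1 \<theta>2 by (meson less_trans)+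
qed

end

section \<open>Orbits of low energy in the strip\<close>

locale vortex_trapped = vortex_solution +
  assumes start: "\<theta>1 < th 0" "th 0 < \<theta>2" and E_less: "E < H \<theta>1 0" "E < H \<theta>2 0"
begin

lemma trapped: "\<theta>1 < th t" "th t < \<theta>2"
  using stays_in_strip[OF E_less] start by blast+

text \<open>In the strip, the level set \<open>H \<theta> W = E\<close> is \<open>rad \<theta> W = R \<theta>\<close>.\<close>
definition R where "R \<theta> = \<alpha> * b / (L \<theta> - E)"

lemma E_less_L: "\<theta>1 \<le> \<theta> \<Longrightarrow> \<theta> \<le> \<theta>2 \<Longrightarrow> E < L \<theta>"
  using L_greater E_less by simp

lemma R_pos: "\<theta>1 \<le> \<theta> \<Longrightarrow> \<theta> \<le> \<theta>2 \<Longrightarrow> 0 < R \<theta>"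
  unfolding R_def using E_less_L \<alpha> b by simp

lemma isCont_R: "\<theta>1 \<le> \<theta> \<Longrightarrow> \<theta> \<le> \<theta>2 \<Longrightarrow> isCont R \<theta>"
  unfolding R_def using E_less_L[of \<theta>] DERIV_isCont[OF DERIV_L[of \<theta>]] \<theta>1 \<theta>2
  by (intro continuous_intros) auto

lemma isCont_k: "isCont k \<theta>"
  using DERIV_k by (rule DERIV_isCont)

lemma H_compare:
  assumes "(\<theta>, W) \<in> Omega \<beta>" "\<theta>1 \<le> \<theta>" "\<theta> \<le> \<theta>2"
  shows "H \<theta> W = E \<longleftrightarrow> rad \<theta> W = R \<theta>" "E < H \<theta> W \<longleftrightarrow> R \<theta> < rad \<theta> W"
  unfolding H_def R_def using rad_pos[OF assms(1)] E_less_L[OF assms(2,3)] \<alpha> b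
  by (auto simp: field_simps)

lemma rad_orbit: "rad (th t) (w t) = R (th t)"
  using H_compare(1)[OF in_Omega] H_conserved trapped[of t] by simp

lemma w_squared: "(w t)\<^sup>2 = (R (th t))\<^sup>2 - (d / b * k (th t))\<^sup>2"
  unfolding rad_orbit[symmetric] rad_def by simp

lemma w_zero_late: "\<exists>t\<ge>T. w t = 0"
proof (rule ccontr)
  assume "\<not> ?thesis"
  then have nz: "w t \<noteq> 0" if "T \<le> t" for t using that by blast
  \<comment> \<open>The factor \<sigma> treats both signs of \<open>w\<close> at once.\<close>
  define \<sigma> where "\<sigma> = sgn (w T)"
  have \<sigma>: "\<sigma> = 1 \<or> \<sigma> = - 1" using nz[of T] by (auto simp: \<sigma>_def sgn_if)
  have pos: "0 < \<sigma> * w t" if "T \<le> t" for t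
  proof (rule ccontr)
    assume "\<not> 0 < \<sigma> * w t"
    then have "\<exists>s. T \<le> s \<and> s \<le> t \<and> \<sigma> * w s = 0"
      using that by (intro IVT2' continuous_on_mult_left continuous_on_w) (auto simp: \<sigma>_def sgn_if)
    then show False using nz \<sigma> by auto
  qed
  have "\<sigma> * th s \<le> \<sigma> * th t" if "T \<le> s" "s \<le> t" for s t
  proof (rule DERIV_nonneg_imp_nondecreasing[OF that(2)], intro exI conjI)
    fix u assume "s \<le> u" "u \<le> t"
    show "((\<lambda>u. \<sigma> * th u) has_real_derivative \<sigma> * F1 \<alpha> \<beta> d (th u) (w u)) (at u)"
      by (intro DERIV_cmult DERIV_th)
    have "\<sigma> * F1 \<alpha> \<beta> d (th u) (w u) = \<alpha> * b * (\<sigma> * w u) / rad (th u) (w u) ^ 3"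
      by (simp add: F1_eq[OF in_Omega])
    then show "0 \<le> \<sigma> * F1 \<alpha> \<beta> d (th u) (w u)"
      using pos[of u] rad_nonneg \<alpha> b \<open>T \<le> s\<close> \<open>s \<le> u\<close> by simp
  qed
  moreover have "\<sigma> * th t \<le> pi / 2" for t
    using \<sigma> th_bounds[of t] pi_gt_zero by auto
  ultimately obtain q where q: "((\<lambda>t. \<sigma> * th t) \<longlongrightarrow> q) at_top"
    using bounded_mono_convergent_at_top[of T "\<lambda>t. \<sigma> * th t"] by blast
  define p where "p = \<sigma> * q"
  have p: "(th \<longlongrightarrow> p) at_top"
    using tendsto_mult_left[OF q, of \<sigma>] \<sigma> by (auto simp: p_def)
  have p_in: "\<theta>1 \<le> p" "p \<le> \<theta>2"
    using tendsto_lowerbound[OF p, of \<theta>1] tendsto_upperbound[OF p, of \<theta>2]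
    by (simp_all add: trapped less_imp_le)
  have Rp: "((\<lambda>t. R (th t)) \<longlongrightarrow> R p) at_top"
    by (rule isCont_tendsto_compose[OF isCont_R[OF p_in] p])
  have kp: "((\<lambda>t. k (th t)) \<longlongrightarrow> k p) at_top"
    by (rule isCont_tendsto_compose[OF isCont_k p])
  \<comment> \<open>Once the angle converges, so does \<open>w\<close>: conservation of energy gives
    its square as a continuous function of the angle, and \<sigma> selects the root.\<close>
  define W where "W = \<sigma> * sqrt ((R p)\<^sup>2 - (d / b * k p)\<^sup>2)"
  have "((\<lambda>t. \<sigma> * sqrt ((R (th t))\<^sup>2 - (d / b * k (th t))\<^sup>2)) \<longlongrightarrow> W) at_top"
    unfolding W_def by (intro tendsto_intros Rp kp)
  moreover have "eventually (\<lambda>t. \<sigma> * sqrt ((R (th t))\<^sup>2 - (d / b * k (th t))\<^sup>2) = w t) at_top"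
    using eventually_ge_at_top[of T]
  proof eventually_elim
    case (elim t)
    then show ?case
      using pos[of t] \<sigma> unfolding w_squared[symmetric] by auto
  qed
  ultimately have W: "(w \<longlongrightarrow> W) at_top" by (rule Lim_transform_eventually)
  have "((\<lambda>t. rad (th t) (w t)) \<longlongrightarrow> rad p W) at_top"
    unfolding rad_def by (intro tendsto_intros kp W)
  moreover have "((\<lambda>t. rad (th t) (w t)) \<longlongrightarrow> R p) at_top"
    unfolding rad_orbit by (rule Rp)
  ultimately have rad: "rad p W = R p"
    by (rule tendsto_unique[OF trivial_limit_at_top_linorder])
  have \<Omega>: "(p, W) \<in> Omega \<beta>"
  proof -
    \<comment> \<open>The limit is not the singular point, because \<open>R p\<close> is
      positive.\<close>
    have "rad \<theta>\<^sub>\<beta> 0 = 0" by (simp add: rad_def theta_beta)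
    then have "p \<noteq> \<theta>\<^sub>\<beta> \<or> W \<noteq> 0" using rad R_pos[OF p_in] by auto
    then show ?thesis unfolding Omega_iff using p_in \<theta>1 \<theta>2 by linarith
  qed
  have "((\<lambda>t. (th t, w t)) \<longlongrightarrow> (p, W)) at_top" by (rule tendsto_Pair[OF p W])
  then have lim: "(x \<longlongrightarrow> (p, W)) at_top" by simp
  have "VF \<alpha> \<beta> d (p, W) = 0"
    by (rule ode_limit_is_equilibrium[of x "VF \<alpha> \<beta> d", OF DERIV_x lim
          loc_lipschitz_at_isCont[OF loc_lipschitz_VF[OF \<Omega>]]])
  then have "(p, W) \<in> {p \<in> Omega \<beta>. VF \<alpha> \<beta> d p = (0, 0)}"
    using \<Omega> by (simp add: zero_prod_def)
  then have "(p, W) \<in> {(\<theta>1, 0), (\<theta>2, 0)}" unfolding equilibria .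
  then consider "p = \<theta>1" "W = 0" | "p = \<theta>2" "W = 0" by blast
  moreover have "H p W = E" using H_compare(1)[OF \<Omega> p_in] rad by blast
  ultimately show False using E_less by cases simp_all
qed

lemma periodic: "\<exists>T>0. \<forall>t. x (t + T) = x t"
proof -
  obtain s where s: "w s = 0" using w_zero_late by blast
  \<comment> \<open>The gap of 1 makes the period positive.\<close>
  obtain s' where s': "s + 1 \<le> s'" "w s' = 0" using w_zero_late by blast
  then show ?thesis
    using periodic_if_two_zeros[OF sol s s'(2)] by (intro exI[of _ "2 * (s' - s)"]) auto
qed

text \<open>By periodicity the angle attains its extrema on a compact interval. There
  \<open>F1\<close> vanishes, hence so does \<open>w\<close>.\<close>

lemma extremes:
  obtains s s' where "w s = 0" "w s' = 0" "th s < \<theta>\<^sub>\<beta>" "\<theta>\<^sub>\<beta> < th s'" "\<And>t. th s \<le> th t" "\<And>t. th t \<le> th s'"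
proof -
  obtain T where T: "0 < T" "\<And>t. x (t + T) = x t" using periodic by blast
  interpret periodic_fun_simple x T by standard (rule T)
  have red: "\<exists>u\<in>{0..T}. x u = x t" for t
  proof
    define u where "u = t - of_int \<lfloor>t / T\<rfloor> * T"
    show "x u = x t" unfolding u_def by (rule minus_of_int)
    show "u \<in> {0..T}"
      using floor_divide_lower[OF T(1), of t] floor_divide_upper[OF T(1), of t]
      by (simp add: u_def distrib_right)
  qed
  obtain s where "\<And>t. t \<in> {0..T} \<Longrightarrow> th s \<le> th t"
    using continuous_attains_inf[OF compact_Icc _ continuous_on_th, of 0 T] T(1)
    by (metis atLeastatMost_empty_iff2 less_imp_le not_le)
  then have s: "th s \<le> th t" for t using red[of t] by metis
  obtain s' where "\<And>t. t \<in> {0..T} \<Longrightarrow> th t \<le> th s'"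
    using continuous_attains_sup[OF compact_Icc _ continuous_on_th, of 0 T] T(1)
    by (metis atLeastatMost_empty_iff2 less_imp_le not_le)
  then have s': "th t \<le> th s'" for t using red[of t] by metis
  have w0: "w t = 0" if "F1 \<alpha> \<beta> d (th t) (w t) = 0" for t
    using that rad_pos[OF in_Omega[of t]] \<alpha> b by (simp add: F1_eq[OF in_Omega])
  have ws: "w s = 0" "w s' = 0"
    using DERIV_local_min[OF DERIV_th[of s] zero_less_one] s
      DERIV_local_max[OF DERIV_th[of s'] zero_less_one] s' by (auto intro: w0)
  \<comment> \<open>A constant angle forces \<open>w\<close> to vanish identically. The constant
    solution is then its own limit, hence an equilibrium, but the strip is open and excludes
    both.\<close>
  have "th s \<noteq> th s'"
  proof
    assume eq: "th s = th s'"
    have th: "th t = th s" for t using s[of t] s'[of t] eq by simp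
    have "F1 \<alpha> \<beta> d (th t) (w t) = 0" for t
      using th[of t] th by (intro DERIV_local_max[OF DERIV_th[of t] zero_less_one]) (metis order_refl)
    then have "w t = 0" for t by (rule w0)
    then have "x = (\<lambda>_. x s)" using th by (simp add: fun_eq_iff prod_eq_iff)
    then have "(x \<longlongrightarrow> x s) at_top" by (metis tendsto_const)
    then have "VF \<alpha> \<beta> d (x s) = (0, 0)"
      unfolding zero_prod_def[symmetric]
      by (intro ode_limit_is_equilibrium[of x "VF \<alpha> \<beta> d"] DERIV_x
          loc_lipschitz_at_isCont loc_lipschitz_VF) (use in_Omega[of s] in simp_all)
    then have "x s \<in> {(\<theta>1, 0), (\<theta>2, 0)}" using equilibria in_Omega[of s] by auto
    then show False using trapped[of s] by auto
  qed
  then have less: "th s < th s'" using s[of s'] by simp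
  have nb: "th s \<noteq> \<theta>\<^sub>\<beta>" "th s' \<noteq> \<theta>\<^sub>\<beta>" using in_Omega[of s] in_Omega[of s'] ws by (auto simp: Omega_iff)
  \<comment> \<open>Two distinct axis points of equal energy cannot lie on the same side of
    \<open>\<theta>\<^sub>\<beta>\<close>, since \<open>H\<close> is strictly monotone on each side
    within the strip.\<close>
  have "H (th s) 0 = H (th s') 0" using H_conserved[of s] H_conserved[of s'] ws by simp
  then have "th s < \<theta>\<^sub>\<beta>" "\<theta>\<^sub>\<beta> < th s'"
    using H_axis_decreasing[of "th s" "th s'"] H_axis_increasing[of "th s" "th s'"] less nb
      trapped[of s] trapped[of s'] by linarith+
  then show ?thesis using that ws s s' by blast
qed

text \<open>Monotonicity on the axis puts \<theta> between the extremal angles, so the orbit reaches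
  this angle at some time. There the energy fixes \<open>W\<close> up to sign, and the other sign is
  reached by time reversal.\<close>

lemma level_curve_in_orbit:
  assumes \<Omega>: "(\<theta>, W) \<in> Omega \<beta>" and \<theta>: "\<theta>1 \<le> \<theta>" "\<theta> \<le> \<theta>2" and HE: "H \<theta> W = E"
  shows "(\<theta>, W) \<in> range x"
proof -
  obtain s s' where s: "w s = 0" "th s < \<theta>\<^sub>\<beta>" and s': "w s' = 0" "\<theta>\<^sub>\<beta> < th s'"
    using extremes by metis
  have Hs: "H (th s) 0 = E" "H (th s') 0 = E" using H_conserved[of s] H_conserved[of s'] s s' by auto
  have le: "H \<theta> 0 \<le> E" if "\<theta> \<noteq> \<theta>\<^sub>\<beta>" using H_le_axis[of \<theta> W] \<Omega> HE that by (simp add: Omega_iff)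
  have "th s \<le> \<theta>"
    using H_axis_decreasing[of \<theta> "th s"] le \<theta>(1) s(2) Hs(1) by linarith
  moreover have "\<theta> \<le> th s'"
    using H_axis_increasing[of "th s'" \<theta>] le \<theta>(2) s'(2) Hs(2) by linarith
  ultimately have "\<theta> \<in> range th"
    using connectedD_interval[OF connected_continuous_image[OF continuous_on_th connected_UNIV], of "th s" "th s'" \<theta>]
    by simp
  then obtain t where t: "th t = \<theta>" by auto
  have "rad \<theta> W = R \<theta>" using H_compare(1)[OF \<Omega> \<theta>] HE by simp
  then have "rad \<theta> W = rad \<theta> (w t)" using rad_orbit[of t] t by simp
  then have "W\<^sup>2 = (w t)\<^sup>2" by (simp add: rad_def)
  then consider "W = w t" | "W = - w t" by (auto simp: power2_eq_iff)
  then show ?thesis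
  proof cases
    case 1
    then have "x t = (\<theta>, W)" using t by (simp add: prod_eq_iff)
    then show ?thesis by (metis rangeI)
  next
    case 2
    then have "x (2 * s - t) = (\<theta>, W)"
      using reflection_at_zero[OF sol s(1), of "2 * s - t"] t by simp
    then show ?thesis by (metis rangeI)
  qed
qed

text \<open>The region \<open>U\<close> inside the level curve is bounded and contains
  \<open>(\<theta>\<^sub>\<beta>, 0)\<close>, and its frontier lies in the orbit. A connected set
  that meets \<open>U\<close> and avoids the orbit stays in \<open>U\<close>.\<close>

lemma bounded_inner_component: "bounded (connected_component_set (- range x) (\<theta>\<^sub>\<beta>, 0))"
proof -
  let ?C = "connected_component_set (- range x) (\<theta>\<^sub>\<beta>, 0)"
  define U where "U = {p \<in> {\<theta>1<..<\<theta>2} \<times> UNIV. rad (fst p) (snd p) - R (fst p) \<in> {..<0}}"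
  \<comment> \<open>A closed set containing \<open>U\<close>, hence its closure: frontier points of
    \<open>U\<close> lie in \<open>V\<close> but not in \<open>U\<close>.\<close>
  define V where "V = {p \<in> {\<theta>1..\<theta>2} \<times> UNIV. rad (fst p) (snd p) - R (fst p) \<in> {..0}}"
  have cont: "continuous_on ({\<theta>1..\<theta>2} \<times> UNIV) (\<lambda>p. rad (fst p) (snd p) - R (fst p))"
  proof -
    have "continuous_on {\<theta>1..\<theta>2} R" "continuous_on UNIV k"
      using isCont_R isCont_k by (auto intro: continuous_at_imp_continuous_on)
    then have "continuous_on ({\<theta>1..\<theta>2} \<times> UNIV) (\<lambda>p::real \<times> real. R (fst p))"
      and "continuous_on ({\<theta>1..\<theta>2} \<times> UNIV) (\<lambda>p::real \<times> real. k (fst p))"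
      by (auto elim!: continuous_on_compose2 intro!: continuous_intros)
    then show ?thesis
      unfolding rad_def by (intro continuous_intros)
  qed
  have "open U"
    unfolding U_def
    by (rule continuous_open_preimage[unfolded vimage_def Int_def mem_Collect_eq])
      (auto intro: continuous_on_subset[OF cont] open_Times)
  have "closed V"
    unfolding V_def
    by (rule continuous_closed_preimage[unfolded vimage_def Int_def mem_Collect_eq])
      (auto intro: cont closed_Times)
  have "U \<subseteq> V" by (auto simp: U_def V_def)
  have "bounded U"
  proof -
    have "compact (R ` {\<theta>1..\<theta>2})"
      using isCont_R by (intro compact_continuous_image continuous_at_imp_continuous_on) auto
    then obtain B where B: "\<forall>\<theta>\<in>{\<theta>1..\<theta>2}. \<bar>R \<theta>\<bar> \<le> B"
      using compact_imp_bounded[of "R ` {\<theta>1..\<theta>2}"] by (auto simp: bounded_iff)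
    have "U \<subseteq> {\<theta>1..\<theta>2} \<times> {- B..B}"
    proof
      fix p assume p: "p \<in> U"
      have "\<bar>snd p\<bar> \<le> rad (fst p) (snd p)" unfolding rad_def by (rule real_le_rsqrt) simp
      then show "p \<in> {\<theta>1..\<theta>2} \<times> {- B..B}"
        using p B[rule_format, of "fst p"] by (cases p) (auto simp: U_def)
    qed
    then show ?thesis by (rule bounded_subset[rotated]) (intro bounded_Times bounded_closed_interval)
  qed
  have frontier: "frontier U \<subseteq> range x"
  proof
    fix p assume p: "p \<in> frontier U"
    obtain \<theta> W where pW: "p = (\<theta>, W)" by fastforce
    have "p \<in> V" "p \<notin> U"
      using p \<open>open U\<close> closure_minimal[OF \<open>U \<subseteq> V\<close> \<open>closed V\<close>] by (auto simp: frontier_def interior_open)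
    then have \<theta>: "\<theta>1 \<le> \<theta>" "\<theta> \<le> \<theta>2" and le: "rad \<theta> W \<le> R \<theta>" and or: "\<theta> = \<theta>1 \<or> \<theta> = \<theta>2 \<or> rad \<theta> W = R \<theta>"
      by (auto simp: U_def V_def pW)
    \<comment> \<open>On the two bounding lines \<open>H\<close> exceeds \<open>E\<close> for every
      \<open>W\<close>, so \<open>rad\<close> exceeds \<open>R\<close> there.\<close>
    have "\<theta> \<noteq> \<theta>1" "\<theta> \<noteq> \<theta>2"
      using H_compare(2)[of \<theta> W] H_le_axis[of \<theta> W] \<theta> le E_less \<theta>1 \<theta>2 theta_beta by (auto simp: Omega_iff)
    then have eq: "rad \<theta> W = R \<theta>" using or by simp
    then have \<Omega>: "(\<theta>, W) \<in> Omega \<beta>"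
      using R_pos[OF \<theta>] \<theta> \<theta>1 \<theta>2 theta_beta by (auto simp: Omega_iff rad_def)
    show "p \<in> range x"
      using level_curve_in_orbit[OF \<Omega> \<theta>] H_compare(1)[OF \<Omega> \<theta>] eq pW by simp
  qed
  have inU: "(\<theta>\<^sub>\<beta>, 0) \<in> U"
    using R_pos[of \<theta>\<^sub>\<beta>] \<theta>1 \<theta>2 theta_beta by (auto simp: U_def rad_def)
  have "?C \<subseteq> U"
  proof (rule ccontr)
    assume "\<not> ?C \<subseteq> U"
    then have ne: "?C \<noteq> {}" "?C - U \<noteq> {}" by auto
    \<comment> \<open>A component set is empty unless its base point lies in the ambient set, so
      nonemptiness already places the base point in it.\<close>
    then have "(\<theta>\<^sub>\<beta>, 0) \<in> ?C"
      by (metis connected_component_eq_empty connected_component_refl mem_Collect_eq)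
    then have "?C \<inter> U \<noteq> {}" using inU by blast
    then have "?C \<inter> frontier U \<noteq> {}"
      using ne by (intro connected_Int_frontier) auto
    then show False using frontier connected_component_subset[of "- range x"] by blast
  qed
  then show ?thesis using \<open>bounded U\<close> bounded_subset by blast
qed

lemma leapfrogging: "leapfrogging \<beta> x"
proof -
  obtain s s' where "th s < \<theta>\<^sub>\<beta>" "\<theta>\<^sub>\<beta> < th s'" using extremes by metis
  then have "x s \<noteq> x s'" by auto
  moreover have "range x \<subseteq> Omega \<beta>" using sol by (auto simp: is_solution_def)
  moreover from this have "(\<theta>\<^sub>\<beta>, 0) \<notin> range x"
    using Omega_iff[of "\<theta>\<^sub>\<beta>" 0] by blast
  ultimately show ?thesis
    unfolding leapfrogging_def using periodic bounded_inner_component by blast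
qed

end

theorem theorem2:
  fixes \<alpha> \<beta> d :: real
  assumes "0 < \<alpha>" "\<alpha> < 1/3" "0 < d" "1 \<le> \<beta>"
  shows "\<exists>\<theta>1 \<theta>2.
           0 < \<theta>1 \<and> \<theta>1 < theta_beta \<beta> \<and> theta_beta \<beta> < \<theta>2 \<and> \<theta>2 < pi / 2 \<and>
           {p \<in> Omega \<beta>. VF \<alpha> \<beta> d p = (0, 0)} = {(\<theta>1, 0), (\<theta>2, 0)} \<and>
           (\<forall>\<theta>0 W0 x. (\<theta>0, W0) \<in> Omega \<beta> \<longrightarrow> is_solution \<alpha> \<beta> d x \<longrightarrow> x 0 = (\<theta>0, W0) \<longrightarrow>
              (leapfrogging \<beta> x \<longleftrightarrow>
                 (\<theta>1 < \<theta>0 \<and> \<theta>0 < \<theta>2 \<and>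
                  Ham \<alpha> \<beta> d \<theta>0 W0 < min (Ham \<alpha> \<beta> d \<theta>1 0) (Ham \<alpha> \<beta> d \<theta>2 0))))"
proof -
  interpret vortex_pair \<alpha> \<beta> d by standard (use assms in auto)
  obtain \<theta>1 \<theta>2 where \<theta>: "0 < \<theta>1" "\<theta>1 < theta_beta \<beta>" "G \<theta>1 = 0"
      "theta_beta \<beta> < \<theta>2" "\<theta>2 < pi / 2" "G \<theta>2 = 0"
    using G_zero_left G_zero_right by auto
  interpret vortex_equilibria \<alpha> \<beta> d \<theta>1 \<theta>2 by standard (use \<theta> in auto)
  have Ham: "Ham \<alpha> \<beta> d \<theta>1 0 = H \<theta>1 0" "Ham \<alpha> \<beta> d \<theta>2 0 = H \<theta>2 0"
    using \<theta> theta_beta by (auto intro!: Ham_eq simp: Omega_iff)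
  have "leapfrogging \<beta> x \<longleftrightarrow> (\<theta>1 < \<theta>0 \<and> \<theta>0 < \<theta>2 \<and>
      Ham \<alpha> \<beta> d \<theta>0 W0 < min (Ham \<alpha> \<beta> d \<theta>1 0) (Ham \<alpha> \<beta> d \<theta>2 0))"
    if \<Omega>: "(\<theta>0, W0) \<in> Omega \<beta>" and x: "is_solution \<alpha> \<beta> d x" "x 0 = (\<theta>0, W0)" for \<theta>0 W0 x
  proof -
    interpret vortex_solution \<alpha> \<beta> d \<theta>1 \<theta>2 x by standard (rule x)
    have E: "Ham \<alpha> \<beta> d \<theta>0 W0 = E" using Ham_eq[OF \<Omega>] x(2) by (simp add: E_def)
    show ?thesis
    proof
      assume "leapfrogging \<beta> x"
      from leapfrogging_imp_trapped[OF this] show "\<theta>1 < \<theta>0 \<and> \<theta>0 < \<theta>2 \<and>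
          Ham \<alpha> \<beta> d \<theta>0 W0 < min (Ham \<alpha> \<beta> d \<theta>1 0) (Ham \<alpha> \<beta> d \<theta>2 0)"
        unfolding Ham E using x(2) by simp
    next
      assume *: "\<theta>1 < \<theta>0 \<and> \<theta>0 < \<theta>2 \<and>
          Ham \<alpha> \<beta> d \<theta>0 W0 < min (Ham \<alpha> \<beta> d \<theta>1 0) (Ham \<alpha> \<beta> d \<theta>2 0)"
      interpret vortex_trapped \<alpha> \<beta> d \<theta>1 \<theta>2 x
        by standard (use * x(2) in \<open>simp_all add: Ham E\<close>)
      show "leapfrogging \<beta> x" by (rule leapfrogging)
    qed
  qed
  then show ?thesis
    using \<theta> equilibria by (intro exI[of _ \<theta>1] exI[of _ \<theta>2] conjI allI impI) simp_all
qed

end
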